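(* Let $C_1,C_2\in(0,\infty)$ be absolute constants (fixed once and for all) and let $1<p<2$. Then there is a constant $D\in(0,\infty)$ depending only on $p$ (with $C_1,C_2$ being fixed) such that the following holds. Let $n\in\mathbb{N}$, let $a_1\geq a_2\geq\dots\geq a_n>0$, and let $M$ be an Orlicz function such that, for some $\epsilon\in(0,p-1)$, the function $t\mapsto M(t)/t^{p-\epsilon}$ is non-increasing. Assume that for all $x\in\mathbb{R}^n$ the Orlicz-Lorentz norm satisfies $$\bigg\| \bigg(\Big(\frac{1}{k}\sum_{i=1}^k|x_i^*|^p \Big)^{1/p}\bigg)_{k=1}^n \bigg\|_{M,a} \leq C_1 \,\|x\|_{M,a}$$ and $$\bigg\| \bigg(\Big(\frac{1}{k}\sum_{i=k+1}^n|x_i^*|^2 \Big)^{1/2}\bigg)_{k=1}^n \bigg\|_{M,a} \leq C_2\, \|x\|_{M,a}.$$ Then there is a subspace $Y_n$ of $L_1^{n!^32^{2n}}$ with $\dim Y_n=n$ such that $d_{BM}(\ell^n_{M,a},Y_n)\leq D$.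
   Context: An Orlicz function is a convex function $M:[0,\infty)\to[0,\infty)$ with $M(0)=0$ and $M(t)>0$ for $t>0$; it is assumed throughout that $\lim_{t\to0}M(t)/t=0$ and $\lim_{t\to\infty}M(t)/t=\infty$. For $x\in\mathbb{R}^n$, $(x_i^* )_{i=1}^n$ denotes the non-increasing rearrangement of $(|x_i|)_{i=1}^n$. For an Orlicz function $M$ and weights $a_1\geq\dots\geq a_n\geq0$, the Orlicz-Lorentz space $\ell^n_{M,a}$ is $\mathbb{R}^n$ with the norm $$\|x\|_{M,a}=\inf\Big\{\rho>0:\ \sum_{i=1}^n M\Big(\frac{a_ix_i^*}{\rho}\Big)\leq1\Big\}.$$ For isomorphic Banach spaces $X,Y$, the Banach-Mazur distance is $d_{BM}(X,Y)=\inf\{\|T\|\,\|T^{-1}\|: T:X\to Y \text{ a linear isomorphism}\}$. Let $\mathfrak{S}_n$ be the group of permutations of $\{1,\dots,n\}$. The space $L_1^{n!^32^{2n}}$ is $\mathbb{R}^{n!^3 2^{2n}}$, with coordinates $x(\pi,\sigma,\eta,\varepsilon,\delta)$ indexed by $\pi,\sigma,\eta\in\mathfrak{S}_n$ and $\varepsilon,\delta\in\{-1,1\}^n$, equipped with the norm $$\|x\|_1=\frac{1}{n!^32^{2n}}\sum_{\pi,\sigma,\eta,\varepsilon,\delta}|x(\pi,\sigma,\eta,\varepsilon,\delta)|.$$ *)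

theory Defs
  imports "HOL-Analysis.Analysis" "HOL-Library.Function_Algebras"
begin

text \<open>
  Dimensions are quantified inside the statement, so coordinate spaces are carriers rather than
  types: \<open>coord_space I\<close> is the space of real vectors indexed by \<open>I\<close>, realised as the functions
  vanishing outside \<open>I\<close>. The pointwise scalar multiplication makes \<^const>\<open>subspace\<close> and \<^const>\<open>dim\<close>
  available for subsets of such spaces.
\<close>

instantiation "fun" :: (type, real_vector) real_vector
begin

definition scaleR_fun :: "real \<Rightarrow> ('a \<Rightarrow> 'b) \<Rightarrow> 'a \<Rightarrow> 'b"
  where "scaleR_fun c f = (\<lambda>i. c *\<^sub>R f i)"

instance
  by standard (auto simp: scaleR_fun_def fun_eq_iff scaleR_add_right scaleR_add_left)

end

definition coord_space :: "'i set \<Rightarrow> ('i \<Rightarrow> real) set"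
  where "coord_space I = {x. \<forall>i. i \<notin> I \<longrightarrow> x i = 0}"

definition orlicz_function :: "(real \<Rightarrow> real) \<Rightarrow> bool"
  where "orlicz_function M \<longleftrightarrow>
    convex_on {0..} M \<and> M 0 = 0 \<and> (\<forall>t>0. M t > 0) \<and>
    ((\<lambda>t. M t / t) \<longlongrightarrow> 0) (at_right 0) \<and> filterlim (\<lambda>t. M t / t) at_top at_top"

text \<open>
  Coordinates are numbered \<open>1, \<dots>, n\<close>; \<open>rearr n x i\<close> is the \<open>i\<close>-th largest of
  \<open>\<bar>x 1\<bar>, \<dots>, \<bar>x n\<bar>\<close>, for \<open>1 \<le> i \<le> n\<close>. It only depends on those coordinates of \<open>x\<close>, and so does
  the norm built on it.
\<close>

definition rearr :: "nat \<Rightarrow> (nat \<Rightarrow> real) \<Rightarrow> nat \<Rightarrow> real"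
  where "rearr n x i = rev (sort (map (\<lambda>j. \<bar>x j\<bar>) [1..<Suc n])) ! (i - 1)"

definition orlicz_lorentz_norm ::
    "nat \<Rightarrow> (real \<Rightarrow> real) \<Rightarrow> (nat \<Rightarrow> real) \<Rightarrow> (nat \<Rightarrow> real) \<Rightarrow> real"
  where "orlicz_lorentz_norm n M a x =
    Inf {\<rho>. \<rho> > 0 \<and> (\<Sum>i=1..n. M (a i * rearr n x i / \<rho>)) \<le> 1}"

text \<open>
  A normed space is given by its carrier and a norm on it. Both directions of an isomorphism are
  required to be bounded, as usual for Banach spaces (automatic in finite dimensions), so the
  suprema in \<open>op_norm\<close> are taken over bounded sets.
\<close>

definition op_norm :: "'a::real_vector set \<Rightarrow> ('a \<Rightarrow> real) \<Rightarrow> ('b::real_vector \<Rightarrow> real) \<Rightarrow> ('a \<Rightarrow> 'b) \<Rightarrow> real"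
  where "op_norm X NX NY T = Sup {NY (T x) | x. x \<in> X \<and> NX x \<le> 1}"

definition linear_isomorphism ::
    "'a::real_vector set \<Rightarrow> ('a \<Rightarrow> real) \<Rightarrow> 'b::real_vector set \<Rightarrow> ('b \<Rightarrow> real) \<Rightarrow> ('a \<Rightarrow> 'b) \<Rightarrow> bool"
  where "linear_isomorphism X NX Y NY T \<longleftrightarrow>
    bij_betw T X Y \<and>
    (\<forall>x\<in>X. \<forall>y\<in>X. T (x + y) = T x + T y) \<and>
    (\<forall>c. \<forall>x\<in>X. T (c *\<^sub>R x) = c *\<^sub>R T x) \<and>
    (\<exists>K. \<forall>x\<in>X. NY (T x) \<le> K * NX x) \<and>
    (\<exists>K. \<forall>y\<in>Y. NX (inv_into X T y) \<le> K * NY y)"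

text \<open>Only meaningful for isomorphic spaces: otherwise the infimum is over the empty set.\<close>

definition banach_mazur ::
    "'a::real_vector set \<Rightarrow> ('a \<Rightarrow> real) \<Rightarrow> 'b::real_vector set \<Rightarrow> ('b \<Rightarrow> real) \<Rightarrow> real"
  where "banach_mazur X NX Y NY =
    Inf {op_norm X NX NY T * op_norm Y NY NX (inv_into X T) | T. linear_isomorphism X NX Y NY T}"

type_synonym l1_index =
  "(nat \<Rightarrow> nat) \<times> (nat \<Rightarrow> nat) \<times> (nat \<Rightarrow> nat) \<times> (nat \<Rightarrow> int) \<times> (nat \<Rightarrow> int)"

text \<open>The tuples \<open>(\<pi>, \<sigma>, \<eta>, \<epsilon>, \<delta>)\<close> of three permutations and two sign vectors.\<close>

definition l1_indices :: "nat \<Rightarrow> l1_index set"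
  where "l1_indices n =
    {\<pi>. \<pi> permutes {1..n}} \<times> {\<sigma>. \<sigma> permutes {1..n}} \<times> {\<eta>. \<eta> permutes {1..n}} \<times>
    ({1..n} \<rightarrow>\<^sub>E {-1, 1}) \<times> ({1..n} \<rightarrow>\<^sub>E {-1, 1})"

definition l1_norm :: "nat \<Rightarrow> (l1_index \<Rightarrow> real) \<Rightarrow> real"
  where "l1_norm n x = 1 / (fact n ^ 3 * 2 ^ (2 * n)) * (\<Sum>t\<in>l1_indices n. \<bar>x t\<bar>)"

end

theory Submission
  imports Defs
begin

text \<open>
  For random permutations \<open>\<pi>, \<sigma>\<close> and signs \<open>\<epsilon>, \<delta>\<close> put
  \<open>f\<^sub>k(x) = \<Sum> {\<epsilon>\<^sub>i x\<^sub>i | k \<pi>(i) \<le> n}\<close>, a Rademacher sum over a random set of density about \<open>1/k\<close>, and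
  map \<open>x\<close> to \<open>\<Sum>\<^sub>k \<delta>\<^sub>k v\<^bsub>\<sigma>(k)\<^esub> a\<^sub>k f\<^sub>k(x)\<close>. The weights \<open>v\<close> depend on \<open>M\<close> and are such that the average
  over \<open>\<sigma>\<close> and \<open>\<delta>\<close> reproduces the Orlicz norm of \<open>(a\<^sub>k f\<^sub>k(x))\<^sub>k\<close>, with a constant depending only on
  \<open>p < 2\<close>. No exact formula for the averaged Orlicz norm is needed, because it can be sandwiched: it
  is at least the norm of \<open>(a\<^sub>k E\<bar>f\<^sub>k(x)\<bar>)\<^sub>k\<close>, by convexity, and \<open>E\<bar>f\<^sub>k(x)\<bar> \<ge> c x\<^sub>k\<^sup>*\<close>; since
  \<open>M(t)/t\<^sup>p\<close> decreases, it is at most a constant times the norm of \<open>(a\<^sub>k (E\<bar>f\<^sub>k(x)\<bar>\<^sup>p)\<^bsup>1/p\<^esup>)\<^sub>k\<close>, and these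
  moments are bounded by the head and tail averages of \<open>x\<^sup>*\<close> which the two hypotheses control.
\<close>

section \<open>Averages over permutations and signs\<close>

text \<open>For an empty or infinite \<open>A\<close> both the sum and the cardinality are 0, and so
  is the value; monotonicity and linearity therefore hold for every set.\<close>

definition avg :: "'a set \<Rightarrow> ('a \<Rightarrow> real) \<Rightarrow> real"
  where "avg A f = (\<Sum>a\<in>A. f a) / real (card A)"

lemma avg_mono: "(\<And>a. a \<in> A \<Longrightarrow> f a \<le> g a) \<Longrightarrow> avg A f \<le> avg A g"
  unfolding avg_def by (intro divide_right_mono sum_mono) auto

lemma avg_nonneg: "(\<And>a. a \<in> A \<Longrightarrow> 0 \<le> f a) \<Longrightarrow> 0 \<le> avg A f"
  unfolding avg_def by (intro divide_nonneg_nonneg sum_nonneg) auto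

lemma avg_cong: "(\<And>a. a \<in> A \<Longrightarrow> f a = g a) \<Longrightarrow> avg A f = avg A g"
  unfolding avg_def by simp

lemma avg_const: "finite A \<Longrightarrow> A \<noteq> {} \<Longrightarrow> avg A (\<lambda>_. c) = c"
  unfolding avg_def by simp

lemma avg_add: "avg A (\<lambda>a. f a + g a) = avg A f + avg A g"
  unfolding avg_def by (simp add: sum.distrib add_divide_distrib)

lemma avg_diff: "avg A (\<lambda>a. f a - g a) = avg A f - avg A g"
  unfolding avg_def by (simp add: sum_subtractf diff_divide_distrib)

lemma avg_cmult: "avg A (\<lambda>a. c * f a) = c * avg A f"
  unfolding avg_def by (simp add: sum_distrib_left)

lemma avg_divide: "avg A (\<lambda>a. f a / c) = avg A f / c"
  using avg_cmult[of A "inverse c" f] by (simp add: field_simps)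

lemma avg_sum: "avg A (\<lambda>a. \<Sum>i\<in>I. f i a) = (\<Sum>i\<in>I. avg A (f i))"
  unfolding avg_def by (subst sum.swap) (simp add: sum_divide_distrib)

lemma avg_swap: "avg A (\<lambda>a. avg B (\<lambda>b. f a b)) = avg B (\<lambda>b. avg A (\<lambda>a. f a b))"
  unfolding avg_def
  by (simp add: sum_divide_distrib[symmetric] mult.commute) (subst sum.swap, simp)

text \<open>The triangle inequality of the Euclidean norm. In the lower estimate it moves the
  average over \<open>\<omega>\<close> inside that norm.\<close>

lemma L2_set_avg_le:
  "L2_set (\<lambda>k. avg A (f k)) I \<le> avg A (\<lambda>a. L2_set (\<lambda>k. f k a) I)"
proof (cases "finite A")
  case True
  then have "L2_set (\<lambda>k. \<Sum>a\<in>A. f k a) I \<le> (\<Sum>a\<in>A. L2_set (\<lambda>k. f k a) I)"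
  proof (induction A)
    case empty
    then show ?case by (simp add: L2_set_def)
  next
    case (insert b A)
    then show ?case by (auto intro: order_trans[OF L2_set_triangle_ineq])
  qed
  then show ?thesis
    unfolding avg_def divide_inverse
    by (subst L2_set_left_distrib[symmetric]) (auto intro: mult_right_mono)
qed (simp add: avg_def L2_set_def)

section \<open>Averages over random permutations\<close>

lemma avg_permutes_transpose:
  assumes "i \<in> A" "j \<in> A"
  shows "avg {\<pi>. \<pi> permutes A} (\<lambda>\<pi>. F (\<pi> \<circ> Transposition.transpose i j))
    = avg {\<pi>. \<pi> permutes A} F"
proof -
  have "bij_betw (\<lambda>\<pi>. \<pi> \<circ> Transposition.transpose i j) {\<pi>. \<pi> permutes A} {\<pi>. \<pi> permutes A}"
    by (rule bij_betw_byWitness[where f' = "\<lambda>\<pi>. \<pi> \<circ> Transposition.transpose i j"])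
      (auto simp: comp_assoc intro!: permutes_compose permutes_swap_id assms)
  from sum.reindex_bij_betw[OF this, of F] show ?thesis
    unfolding avg_def by simp
qed

text \<open>Transposing positions shows that all of them give the same average, and the sum of
  \<open>f (\<pi> j)\<close> over all \<open>j\<close> does not depend on
  \<open>\<pi>\<close>.\<close>

lemma avg_permutes_apply:
  assumes A: "finite A" and i: "i \<in> A"
  shows "avg {\<pi>. \<pi> permutes A} (\<lambda>\<pi>. f (\<pi> i)) = avg A f"
proof -
  let ?P = "{\<pi>. \<pi> permutes A}"
  have eq: "avg ?P (\<lambda>\<pi>. f (\<pi> j)) = avg ?P (\<lambda>\<pi>. f (\<pi> i))" if "j \<in> A" for j
    using avg_permutes_transpose[OF i that, of "\<lambda>\<pi>. f (\<pi> i)"] by simp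
  have ne: "?P \<noteq> {}" using permutes_id by blast
  have "real (card A) * avg ?P (\<lambda>\<pi>. f (\<pi> i)) = (\<Sum>j\<in>A. avg ?P (\<lambda>\<pi>. f (\<pi> j)))"
  proof -
    have "(\<Sum>j\<in>A. avg ?P (\<lambda>\<pi>. f (\<pi> j))) = (\<Sum>j\<in>A. avg ?P (\<lambda>\<pi>. f (\<pi> i)))"
      by (intro sum.cong refl eq)
    then show ?thesis by simp
  qed
  also have "\<dots> = avg ?P (\<lambda>\<pi>. \<Sum>j\<in>A. f (\<pi> j))"
    by (simp add: avg_sum)
  also have "\<dots> = avg ?P (\<lambda>_. \<Sum>j\<in>A. f j)"
    by (intro avg_cong) (auto intro: sum.permute[symmetric, unfolded comp_def])
  also have "\<dots> = (\<Sum>j\<in>A. f j)"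
    using finite_permutations[OF A] ne by (rule avg_const)
  finally have "avg ?P (\<lambda>\<pi>. f (\<pi> i)) * real (card A) = (\<Sum>j\<in>A. f j)"
    by (simp add: mult.commute)
  moreover have "real (card A) \<noteq> 0" using A i by auto
  ultimately have "avg ?P (\<lambda>\<pi>. f (\<pi> i)) = (\<Sum>j\<in>A. f j) / real (card A)"
    by (metis nonzero_mult_div_cancel_right)
  then show ?thesis by (simp only: avg_def[of A f])
qed

text \<open>Sampling without replacement: transposing positions other than \<open>k\<close> equates
  the averages for all second positions, and adding the nonnegative term at \<open>k\<close>
  completes the sum of \<open>g\<close>. The factor 2 bounds
  \<open>card A / (card A - 1)\<close>.\<close>

lemma avg_permutes_apply2_le:
  assumes A: "finite A" and kl: "k \<in> A" "l \<in> A" "k \<noteq> l"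
    and f: "\<And>j. j \<in> A \<Longrightarrow> 0 \<le> f j" and g: "\<And>j. j \<in> A \<Longrightarrow> 0 \<le> g j"
  shows "avg {\<pi>. \<pi> permutes A} (\<lambda>\<pi>. f (\<pi> k) * g (\<pi> l)) \<le> 2 * avg A f * avg A g"
proof -
  let ?P = "{\<pi>. \<pi> permutes A}"
  let ?E = "avg ?P (\<lambda>\<pi>. f (\<pi> k) * g (\<pi> l))"
  have eq: "avg ?P (\<lambda>\<pi>. f (\<pi> k) * g (\<pi> j)) = ?E" if "j \<in> A - {k}" for j
    using avg_permutes_transpose[of l A j "\<lambda>\<pi>. f (\<pi> k) * g (\<pi> l)"] that kl
    by (auto simp: transpose_def)
  have c2: "card A \<ge> 2"
    using card_mono[of A "{k, l}"] A kl by auto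
  have "(real (card A) - 1) * ?E = (\<Sum>j\<in>A-{k}. avg ?P (\<lambda>\<pi>. f (\<pi> k) * g (\<pi> j)))"
  proof -
    have "(\<Sum>j\<in>A-{k}. avg ?P (\<lambda>\<pi>. f (\<pi> k) * g (\<pi> j))) = (\<Sum>j\<in>A-{k}. ?E)"
      by (intro sum.cong refl eq)
    then show ?thesis using A kl c2 by (simp add: of_nat_diff)
  qed
  also have "\<dots> = avg ?P (\<lambda>\<pi>. \<Sum>j\<in>A-{k}. f (\<pi> k) * g (\<pi> j))"
    by (simp add: avg_sum)
  also have "\<dots> \<le> avg ?P (\<lambda>\<pi>. (\<Sum>j\<in>A. g j) * f (\<pi> k))"
  proof (rule avg_mono)
    fix \<pi> assume "\<pi> \<in> ?P"
    then have \<pi>: "\<pi> permutes A" by simp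
    have "(\<Sum>j\<in>A-{k}. g (\<pi> j)) \<le> (\<Sum>j\<in>A. g (\<pi> j))"
      using A g permutes_in_image[OF \<pi>] by (intro sum_mono2) auto
    also have "\<dots> = (\<Sum>j\<in>A. g j)"
      using sum.permute[OF \<pi>, of g] by (simp add: comp_def)
    finally show "(\<Sum>j\<in>A-{k}. f (\<pi> k) * g (\<pi> j)) \<le> (\<Sum>j\<in>A. g j) * f (\<pi> k)"
      unfolding sum_distrib_left[symmetric]
      using f[of "\<pi> k"] permutes_in_image[OF \<pi>, of k] kl
      by (subst mult.commute, intro mult_right_mono) auto
  qed
  also have "\<dots> = (\<Sum>j\<in>A. g j) * avg A f"
    using kl by (simp add: avg_cmult avg_permutes_apply[OF A])
  also have "\<dots> = real (card A) * (avg A f * avg A g)"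
    using c2 by (simp add: avg_def)
  finally have 1: "(real (card A) - 1) * ?E \<le> real (card A) * (avg A f * avg A g)" .
  have "real (card A) * (avg A f * avg A g) \<le> (2 * (real (card A) - 1)) * (avg A f * avg A g)"
    using c2 f g by (intro mult_right_mono mult_nonneg_nonneg avg_nonneg) auto
  also have "\<dots> = (real (card A) - 1) * (2 * avg A f * avg A g)"
    by (simp only: mult_ac)
  finally have "(real (card A) - 1) * ?E \<le> (real (card A) - 1) * (2 * avg A f * avg A g)"
    using 1 by linarith
  then show ?thesis using c2 by (subst (asm) mult_le_cancel_left_pos) auto
qed

section \<open>Expected Euclidean norms of randomly permuted weights\<close>

text \<open>Quadratic up to 1 and linear beyond: sums of averages of \<phi> control the expected
  Euclidean norm of a random vector from both sides.\<close>

definition \<phi> :: "real \<Rightarrow> real"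
  where "\<phi> s = s * min s 1"

lemma phi_nonneg: "0 \<le> s \<Longrightarrow> 0 \<le> \<phi> s"
  by (simp add: \<phi>_def)

lemma phi_mono: "0 \<le> s \<Longrightarrow> s \<le> t \<Longrightarrow> \<phi> s \<le> \<phi> t"
  unfolding \<phi>_def by (intro mult_mono) auto

text \<open>The squared inequality goes by induction from
  \<open>s\<^sup>2 \<le> \<phi> s + (\<phi> s)\<^sup>2\<close>; the linear term is paid for by the
  cross term that the constant 1/2 produces.\<close>

lemma sqrt_sum_le_phi:
  assumes "finite I" and "\<And>i. i \<in> I \<Longrightarrow> 0 \<le> s i"
  shows "sqrt (\<Sum>i\<in>I. (s i)\<^sup>2) \<le> 1/2 + (\<Sum>i\<in>I. \<phi> (s i))"
proof -
  have "(\<Sum>i\<in>I. (s i)\<^sup>2) \<le> (1/2 + (\<Sum>i\<in>I. \<phi> (s i)))\<^sup>2"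
    using assms
  proof (induction I)
    case (insert j I)
    let ?Q = "\<Sum>i\<in>I. \<phi> (s i)"
    have Q: "0 \<le> ?Q" and p: "0 \<le> \<phi> (s j)"
      using insert by (auto intro!: sum_nonneg phi_nonneg)
    have "(s j)\<^sup>2 \<le> \<phi> (s j) + (\<phi> (s j))\<^sup>2"
      using insert.prems[of j] by (auto simp: \<phi>_def min_def power2_eq_square)
    also have "\<dots> \<le> 2 * (1/2 + ?Q) * \<phi> (s j) + (\<phi> (s j))\<^sup>2"
      using Q p by (simp add: algebra_simps)
    finally have "(\<Sum>i\<in>insert j I. (s i)\<^sup>2)
        \<le> (1/2 + ?Q)\<^sup>2 + 2 * (1/2 + ?Q) * \<phi> (s j) + (\<phi> (s j))\<^sup>2"
      using insert by simp
    also have "\<dots> = (1/2 + (\<Sum>i\<in>insert j I. \<phi> (s i)))\<^sup>2"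
      using insert.hyps by (simp add: power2_eq_square algebra_simps)
    finally show ?case .
  qed simp
  then show ?thesis
    using assms by (intro real_le_lsqrt) (auto intro!: add_nonneg_nonneg sum_nonneg phi_nonneg)
qed

text \<open>The left side is the tangent at \<open>D0\<close> of the convex function
  \<open>1 / sqrt D\<close>; in terms of the square roots the inequality becomes a factored
  cubic.\<close>

lemma inverse_sqrt_tangent:
  fixes D D0 :: real
  assumes "0 < D" "0 < D0"
  shows "(3/2 - D / (2 * D0)) / sqrt D0 \<le> 1 / sqrt D"
proof -
  define x y where "x = sqrt D" and "y = sqrt D0"
  have xy: "x > 0" "y > 0" and D: "D = x\<^sup>2" "D0 = y\<^sup>2"
    using assms by (auto simp: x_def y_def)
  have "0 \<le> (x - y)\<^sup>2 * (x + 2 * y)"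
    using xy by (intro mult_nonneg_nonneg) auto
  also have "\<dots> = x ^ 3 + 2 * y ^ 3 - 3 * x * y\<^sup>2"
    by algebra
  finally have "3 * x * y\<^sup>2 - x ^ 3 \<le> 2 * y ^ 3" by simp
  then have "(3/2 - x\<^sup>2 / (2 * y\<^sup>2)) / y \<le> 1 / x"
    using xy by (simp add: field_simps power2_eq_square power3_eq_cube)
  then show ?thesis unfolding x_def y_def using assms by simp
qed

text \<open>
  The lower bound comes from \<open>R \<ge> Q / sqrt D\<close> with \<open>Q = \<Sum> \<phi> s\<close> and \<open>D = \<Sum> (min s 1)\<^sup>2\<close>, by the
  Cauchy-Schwarz inequality; replacing \<open>1 / sqrt D\<close> by a tangent line leaves only the first
  two moments, which the near independence of the values of a random permutation controls.
\<close>

lemma avg_permutes_sqrt_ge: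
  assumes A: "finite A" and z: "\<And>i. i \<in> A \<Longrightarrow> 0 \<le> z i" and w: "\<And>j. j \<in> A \<Longrightarrow> 0 \<le> w j"
    and q: "q \<le> (\<Sum>i\<in>A. avg A (\<lambda>j. \<phi> (z i * w j)))" "0 \<le> q"
  shows "q / sqrt (1 + 2 * q)
    \<le> avg {\<pi>. \<pi> permutes A} (\<lambda>\<pi>. sqrt (\<Sum>i\<in>A. (z i * w (\<pi> i))\<^sup>2))"
proof -
  let ?P = "{\<pi>. \<pi> permutes A}"
  define q' where "q' = (\<Sum>i\<in>A. avg A (\<lambda>j. \<phi> (z i * w j)))"
  define D0 where "D0 = 1 + 2 * q'"
  define Q where "Q \<pi> = (\<Sum>i\<in>A. \<phi> (z i * w (\<pi> i)))" for \<pi>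
  define D where "D \<pi> = (\<Sum>i\<in>A. (min (z i * w (\<pi> i)) 1)\<^sup>2)" for \<pi>
  define R where "R \<pi> = sqrt (\<Sum>i\<in>A. (z i * w (\<pi> i))\<^sup>2)" for \<pi>
  have qq: "q \<le> q'" "0 \<le> q'" using q by (auto simp: q'_def)
  have D0: "D0 > 0" using qq by (simp add: D0_def)
  have s0: "0 \<le> z i * w (\<pi> i)" if "i \<in> A" "\<pi> \<in> ?P" for i \<pi>
    using that z w permutes_in_image[of \<pi> A i] by auto
  have pw: "(3/2 * Q \<pi> - Q \<pi> * D \<pi> / (2 * D0)) / sqrt D0 \<le> R \<pi>" if "\<pi> \<in> ?P" for \<pi>
  proof (cases "D \<pi> = 0")
    case True
    then have "\<forall>i\<in>A. (min (z i * w (\<pi> i)) 1)\<^sup>2 = 0"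
      unfolding D_def using A by (subst (asm) sum_nonneg_eq_0_iff) auto
    then have "Q \<pi> = 0" unfolding Q_def \<phi>_def by (intro sum.neutral) auto
    then show ?thesis unfolding R_def by (simp add: sum_nonneg)
  next
    case False
    moreover have "0 \<le> D \<pi>"
      unfolding D_def by (intro sum_nonneg) auto
    ultimately have Dp: "D \<pi> > 0" by linarith
    have Q0: "0 \<le> Q \<pi>"
      unfolding Q_def using s0[OF _ that] by (intro sum_nonneg phi_nonneg)
    have "Q \<pi> = (\<Sum>i\<in>A. \<bar>z i * w (\<pi> i)\<bar> * \<bar>min (z i * w (\<pi> i)) 1\<bar>)"
      unfolding Q_def \<phi>_def by (intro sum.cong) (use s0[OF _ that] in auto)
    also have "\<dots> \<le> R \<pi> * sqrt (D \<pi>)"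
      using L2_set_mult_ineq unfolding R_def D_def L2_set_def .
    finally have "Q \<pi> \<le> R \<pi> * sqrt (D \<pi>)" .
    then have "Q \<pi> * (1 / sqrt (D \<pi>)) \<le> R \<pi>"
      using Dp by (simp add: field_simps)
    moreover have "Q \<pi> * ((3/2 - D \<pi> / (2 * D0)) / sqrt D0) \<le> Q \<pi> * (1 / sqrt (D \<pi>))"
      using inverse_sqrt_tangent[OF Dp D0] Q0 by (rule mult_left_mono)
    ultimately show ?thesis by (simp add: algebra_simps)
  qed
  have EQ: "avg ?P Q = q'"
    unfolding Q_def q'_def avg_sum by (intro sum.cong avg_permutes_apply A) auto
  \<comment> \<open>The diagonal terms add at most \<open>q'\<close>, as the squared truncation is
    at most 1. The second summand \<open>2 * q' * q'\<close> comes from the bound for pairs of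
    values together with \<open>(min s 1)\<^sup>2 \<le> \<phi> s\<close>.\<close>
  have EQD: "avg ?P (\<lambda>\<pi>. Q \<pi> * D \<pi>) \<le> q' + 2 * q' * q'"
  proof -
    have "avg ?P (\<lambda>\<pi>. Q \<pi> * D \<pi>)
        \<le> (\<Sum>k\<in>A. \<Sum>l\<in>A. avg ?P (\<lambda>\<pi>. \<phi> (z k * w (\<pi> k)) * (min (z l * w (\<pi> l)) 1)\<^sup>2))"
      unfolding Q_def D_def sum_product by (simp add: avg_sum)
    also have "\<dots> \<le> (\<Sum>k\<in>A. \<Sum>l\<in>A. (if k = l then avg A (\<lambda>j. \<phi> (z k * w j)) else 0)
        + 2 * avg A (\<lambda>j. \<phi> (z k * w j)) * avg A (\<lambda>j. \<phi> (z l * w j)))"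
    proof (intro sum_mono)
      fix k l assume kl: "k \<in> A" "l \<in> A"
      have n0: "0 \<le> avg A (\<lambda>j. \<phi> (z i * w j))" if "i \<in> A" for i
        using that z w by (intro avg_nonneg phi_nonneg) auto
      show "avg ?P (\<lambda>\<pi>. \<phi> (z k * w (\<pi> k)) * (min (z l * w (\<pi> l)) 1)\<^sup>2)
        \<le> (if k = l then avg A (\<lambda>j. \<phi> (z k * w j)) else 0)
          + 2 * avg A (\<lambda>j. \<phi> (z k * w j)) * avg A (\<lambda>j. \<phi> (z l * w j))"
      proof (cases "k = l")
        case True
        have "avg ?P (\<lambda>\<pi>. \<phi> (z k * w (\<pi> k)) * (min (z k * w (\<pi> k)) 1)\<^sup>2)
            \<le> avg ?P (\<lambda>\<pi>. \<phi> (z k * w (\<pi> k)))"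
        proof (rule avg_mono)
          fix \<pi> assume "\<pi> \<in> ?P"
          from s0[OF kl(1) this]
          show "\<phi> (z k * w (\<pi> k)) * (min (z k * w (\<pi> k)) 1)\<^sup>2 \<le> \<phi> (z k * w (\<pi> k))"
            by (intro mult_left_le phi_nonneg power_le_one) auto
        qed
        also have "\<dots> = avg A (\<lambda>j. \<phi> (z k * w j))"
          by (intro avg_permutes_apply[where f = "\<lambda>j. \<phi> (z k * w j)"] A kl)
        finally have "avg ?P (\<lambda>\<pi>. \<phi> (z k * w (\<pi> k)) * (min (z k * w (\<pi> k)) 1)\<^sup>2)
            \<le> avg A (\<lambda>j. \<phi> (z k * w j))" .
        moreover have "0 \<le> 2 * avg A (\<lambda>j. \<phi> (z k * w j)) * avg A (\<lambda>j. \<phi> (z l * w j))"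
          using n0 kl by (intro mult_nonneg_nonneg) auto
        ultimately show ?thesis
          unfolding True[symmetric] if_P[OF refl] by linarith
      next
        case False
        have "avg ?P (\<lambda>\<pi>. \<phi> (z k * w (\<pi> k)) * (min (z l * w (\<pi> l)) 1)\<^sup>2)
            \<le> 2 * avg A (\<lambda>j. \<phi> (z k * w j)) * avg A (\<lambda>j. (min (z l * w j) 1)\<^sup>2)"
          using z w kl by (intro avg_permutes_apply2_le A kl False phi_nonneg) auto
        also have "\<dots> \<le> 2 * avg A (\<lambda>j. \<phi> (z k * w j)) * avg A (\<lambda>j. \<phi> (z l * w j))"
        proof (intro mult_left_mono avg_mono)
          fix j assume "j \<in> A"
          then have "0 \<le> z l * w j" using z w kl by auto
          then show "(min (z l * w j) 1)\<^sup>2 \<le> \<phi> (z l * w j)"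
            unfolding \<phi>_def power2_eq_square by (intro mult_right_mono) auto
        qed (use n0 kl in auto)
        finally show ?thesis using False by simp
      qed
    qed
    also have "\<dots> = q' + 2 * q' * q'"
      using A by (simp add: sum.distrib q'_def sum_product sum_distrib_left sum_distrib_right mult_ac)
    finally show ?thesis .
  qed
  \<comment> \<open>The function \<open>q / sqrt (1 + 2 * q)\<close> increases, so it suffices to
    treat the exact sum \<open>q'\<close>.\<close>
  have "q / sqrt (1 + 2 * q) \<le> q' / sqrt (1 + 2 * q')"
  proof -
    have "q\<^sup>2 * (1 + 2 * q') \<le> q'\<^sup>2 * (1 + 2 * q)"
    proof -
      have "q\<^sup>2 \<le> q'\<^sup>2" using q qq by (intro power_mono) auto
      moreover have "q * q' * q \<le> q * q' * q'"
        using q qq by (intro mult_left_mono) auto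
      ultimately show ?thesis by (simp add: algebra_simps power2_eq_square)
    qed
    then have "sqrt (q\<^sup>2 * (1 + 2 * q')) \<le> sqrt (q'\<^sup>2 * (1 + 2 * q))" by simp
    then have "q * sqrt (1 + 2 * q') \<le> q' * sqrt (1 + 2 * q)"
      using q(2) qq(2) by (simp add: real_sqrt_mult)
    moreover have "0 < sqrt (1 + 2 * q)" "0 < sqrt (1 + 2 * q')"
      using q(2) qq(2) by auto
    ultimately show ?thesis by (simp only: pos_divide_le_eq times_divide_eq_left pos_le_divide_eq)
  qed
  \<comment> \<open>The tangent point \<open>D0\<close> makes the bound for the average of
    \<open>Q * D\<close> equal to \<open>q' * D0\<close>, so the bracket is
    \<open>3/2 * q' - q' / 2\<close>.\<close>
  also have "q' / sqrt (1 + 2 * q') = (3/2 * q' - (q' + 2 * q' * q') / (2 * D0)) / sqrt D0"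
  proof -
    have "q' + 2 * q' * q' = q' * D0" by (simp add: D0_def algebra_simps)
    then show ?thesis using D0 by (simp add: D0_def[symmetric])
  qed
  also have "\<dots> \<le> (3/2 * avg ?P Q - avg ?P (\<lambda>\<pi>. Q \<pi> * D \<pi>) / (2 * D0)) / sqrt D0"
    using EQD D0 unfolding EQ by (intro divide_right_mono diff_mono) auto
  also have "\<dots> = avg ?P (\<lambda>\<pi>. (3/2 * Q \<pi> - Q \<pi> * D \<pi> / (2 * D0)) / sqrt D0)"
    by (simp only: avg_divide avg_diff avg_cmult)
  also have "\<dots> \<le> avg ?P R"
    using pw by (intro avg_mono) auto
  finally show ?thesis unfolding R_def .
qed

section \<open>Rademacher sums and Khintchine's inequality\<close>

lemma avg_signs_insert:
  assumes "finite A" "b \<notin> A"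
  shows "avg (insert b A \<rightarrow>\<^sub>E {-1, 1::int}) F
    = avg (A \<rightarrow>\<^sub>E {-1, 1}) (\<lambda>\<epsilon>. (F (\<epsilon>(b := -1)) + F (\<epsilon>(b := 1))) / 2)"
proof -
  let ?S = "A \<rightarrow>\<^sub>E {-1, 1::int}"
  have "bij_betw (\<lambda>(y, g). g(b := y)) ({-1, 1} \<times> ?S) (insert b A \<rightarrow>\<^sub>E {-1, 1})"
    unfolding bij_betw_def
    using inj_combinator[OF assms(2), of "\<lambda>_. {-1, 1::int}"] by (simp add: PiE_insert_eq)
  from sum.reindex_bij_betw[OF this, of F]
  have "(\<Sum>\<epsilon>\<in>insert b A \<rightarrow>\<^sub>E {-1, 1}. F \<epsilon>) = (\<Sum>x\<in>{-1, 1} \<times> ?S. F ((snd x)(b := fst x)))"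
    by (simp add: case_prod_beta)
  also have "\<dots> = (\<Sum>y\<in>{-1, 1}. \<Sum>\<epsilon>\<in>?S. F (\<epsilon>(b := y)))"
    by (subst sum.cartesian_product) (simp add: case_prod_beta)
  finally have 1: "(\<Sum>\<epsilon>\<in>insert b A \<rightarrow>\<^sub>E {-1, 1}. F \<epsilon>) = (\<Sum>\<epsilon>\<in>?S. F (\<epsilon>(b := -1)) + F (\<epsilon>(b := 1)))"
    by (simp add: sum.distrib)
  show ?thesis
    unfolding avg_def 1 using assms
    by (simp add: card_PiE sum_divide_distrib)
qed

text \<open>Averaging over one new sign cancels the odd powers and leaves
  \<open>X\<^sup>2 + c\<^sup>2\<close> and \<open>X ^ 4 + 6 * c\<^sup>2 * X\<^sup>2 + c ^ 4\<close>.
  The constant 3 is the one for which the cross term matches that of the square.\<close>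

lemma rademacher_moments:
  assumes "finite A"
  shows "avg (A \<rightarrow>\<^sub>E {-1, 1::int}) (\<lambda>\<epsilon>. (\<Sum>i\<in>A. real_of_int (\<epsilon> i) * c i)\<^sup>2) = (\<Sum>i\<in>A. (c i)\<^sup>2)"
    and "avg (A \<rightarrow>\<^sub>E {-1, 1::int}) (\<lambda>\<epsilon>. (\<Sum>i\<in>A. real_of_int (\<epsilon> i) * c i) ^ 4)
      \<le> 3 * (\<Sum>i\<in>A. (c i)\<^sup>2)\<^sup>2"
  using assms
proof (induction A)
  case (insert b A)
  let ?S = "A \<rightarrow>\<^sub>E {-1, 1::int}"
  let ?X = "\<lambda>\<epsilon>. \<Sum>i\<in>A. real_of_int (\<epsilon> i) * c i"
  have upd: "(\<Sum>i\<in>insert b A. real_of_int ((\<epsilon>(b := y)) i) * c i) = y * c b + ?X \<epsilon>" for \<epsilon> and y :: int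
  proof -
    have "(\<Sum>i\<in>A. real_of_int ((\<epsilon>(b := y)) i) * c i) = ?X \<epsilon>"
      using insert.hyps by (intro sum.cong) auto
    then show ?thesis using insert.hyps by simp
  qed
  have ne: "finite ?S" "?S \<noteq> {}"
    using insert.hyps by (auto simp: finite_PiE PiE_eq_empty_iff)
  {
    case 1
    have "avg (insert b A \<rightarrow>\<^sub>E {-1, 1}) (\<lambda>\<epsilon>. (\<Sum>i\<in>insert b A. real_of_int (\<epsilon> i) * c i)\<^sup>2)
        = avg ?S (\<lambda>\<epsilon>. (?X \<epsilon>)\<^sup>2 + (c b)\<^sup>2)"
      unfolding avg_signs_insert[OF insert.hyps] upd
      by (intro avg_cong) (simp add: power2_eq_square algebra_simps)
    then show ?case
      using insert.hyps insert.IH(1) by (simp add: avg_add avg_const[OF ne])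
  next
    case 2
    have "avg (insert b A \<rightarrow>\<^sub>E {-1, 1}) (\<lambda>\<epsilon>. (\<Sum>i\<in>insert b A. real_of_int (\<epsilon> i) * c i) ^ 4)
        = avg ?S (\<lambda>\<epsilon>. (?X \<epsilon>) ^ 4 + (6 * (c b)\<^sup>2 * (?X \<epsilon>)\<^sup>2 + (c b) ^ 4))"
      unfolding avg_signs_insert[OF insert.hyps] upd
      by (intro avg_cong) (simp, algebra)
    also have "\<dots> = avg ?S (\<lambda>\<epsilon>. (?X \<epsilon>) ^ 4) + (6 * (c b)\<^sup>2 * (\<Sum>i\<in>A. (c i)\<^sup>2) + (c b) ^ 4)"
      using insert.IH(1) by (simp add: avg_add avg_cmult avg_const[OF ne])
    also have "\<dots> \<le> 3 * (\<Sum>i\<in>A. (c i)\<^sup>2)\<^sup>2 + (6 * (c b)\<^sup>2 * (\<Sum>i\<in>A. (c i)\<^sup>2) + 3 * (c b) ^ 4)"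
      using insert.IH(2) by (intro add_mono) auto
    also have "\<dots> = 3 * (\<Sum>i\<in>insert b A. (c i)\<^sup>2)\<^sup>2"
      using insert.hyps by (simp, algebra)
    finally show ?case .
  }
qed (auto simp: avg_def)

text \<open>Write \<open>\<bar>X\<bar> = X\<^sup>2 / sqrt (X\<^sup>2)\<close> and replace the
  inverse root by its tangent at three times the second moment: only the second and fourth moments
  remain.\<close>

lemma khintchine_lower:
  assumes A: "finite A"
  shows "sqrt (\<Sum>i\<in>A. (c i)\<^sup>2) / sqrt 3
    \<le> avg (A \<rightarrow>\<^sub>E {-1, 1::int}) (\<lambda>\<epsilon>. \<bar>\<Sum>i\<in>A. real_of_int (\<epsilon> i) * c i\<bar>)"
proof -
  let ?S = "A \<rightarrow>\<^sub>E {-1, 1::int}"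
  let ?X = "\<lambda>\<epsilon>. \<Sum>i\<in>A. real_of_int (\<epsilon> i) * c i"
  define E where "E = (\<Sum>i\<in>A. (c i)\<^sup>2)"
  show ?thesis
  proof (cases "E = 0")
    case True
    then show ?thesis by (auto simp: E_def intro!: avg_nonneg)
  next
    case False
    moreover have "0 \<le> E" unfolding E_def by (intro sum_nonneg) auto
    ultimately have E: "E > 0" by linarith
    have pw: "(3/2 * (?X \<epsilon>)\<^sup>2 - (?X \<epsilon>) ^ 4 / (2 * (3 * E))) / sqrt (3 * E) \<le> \<bar>?X \<epsilon>\<bar>" for \<epsilon>
    proof (cases "?X \<epsilon> = 0")
      case False
      then have "(?X \<epsilon>)\<^sup>2 * ((3/2 - (?X \<epsilon>)\<^sup>2 / (2 * (3 * E))) / sqrt (3 * E))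
          \<le> (?X \<epsilon>)\<^sup>2 * (1 / sqrt ((?X \<epsilon>)\<^sup>2))"
        using E by (intro mult_left_mono inverse_sqrt_tangent) auto
      moreover have "(?X \<epsilon>)\<^sup>2 * (1 / sqrt ((?X \<epsilon>)\<^sup>2)) = \<bar>?X \<epsilon>\<bar>"
        using real_div_sqrt[of "(?X \<epsilon>)\<^sup>2"] by simp
      moreover have "(?X \<epsilon>)\<^sup>2 * ((3/2 - (?X \<epsilon>)\<^sup>2 / (2 * (3 * E))) / sqrt (3 * E))
        = (3/2 * (?X \<epsilon>)\<^sup>2 - (?X \<epsilon>) ^ 4 / (2 * (3 * E))) / sqrt (3 * E)"
        by (simp add: algebra_simps power2_eq_square power4_eq_xxxx)
      ultimately show ?thesis by (simp only:)
    qed simp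
    have "sqrt E / sqrt 3 = (3/2 * E - (3 * E\<^sup>2) / (2 * (3 * E))) / sqrt (3 * E)"
      using E by (simp add: real_sqrt_mult power2_eq_square field_simps)
    also have "\<dots> \<le> (3/2 * avg ?S (\<lambda>\<epsilon>. (?X \<epsilon>)\<^sup>2) - avg ?S (\<lambda>\<epsilon>. (?X \<epsilon>) ^ 4) / (2 * (3 * E))) / sqrt (3 * E)"
      using rademacher_moments[OF A, of c] E
      by (intro divide_right_mono diff_mono) (auto simp: E_def)
    also have "\<dots> = avg ?S (\<lambda>\<epsilon>. (3/2 * (?X \<epsilon>)\<^sup>2 - (?X \<epsilon>) ^ 4 / (2 * (3 * E))) / sqrt (3 * E))"
      by (simp only: avg_divide avg_diff avg_cmult)
    also have "\<dots> \<le> avg ?S (\<lambda>\<epsilon>. \<bar>?X \<epsilon>\<bar>)"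
      using pw by (intro avg_mono) auto
    finally show ?thesis by (simp add: E_def)
  qed
qed

section \<open>Weights generating an Orlicz function\<close>

text \<open>The right side is the tangent at 1 of the concave power \<open>r powr s\<close>.\<close>

lemma powr_le_tangent:
  fixes r s :: real
  assumes "0 \<le> r" "0 \<le> s" "s \<le> 1"
  shows "r powr s \<le> 1 - s + s * r"
proof (cases "r = 0")
  case False
  then show ?thesis using Youngs_inequality_0[of s "1 - s" r 1] assms by simp
qed (use assms in auto)

section \<open>Growth of the Orlicz function\<close>

locale p_orlicz =
  fixes M :: "real \<Rightarrow> real" and p :: real
  assumes orlicz: "orlicz_function M"
    and p: "1 < p" "p < 2"
    and decr: "antimono_on {0<..} (\<lambda>t. M t / t powr p)"
begin

lemma M0: "M 0 = 0" and Mpos: "0 < t \<Longrightarrow> 0 < M t" and Mconv: "convex_on {0..} M"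
  using orlicz by (auto simp: orlicz_function_def)

lemma Mnonneg: "0 \<le> t \<Longrightarrow> 0 \<le> M t"
  using M0 Mpos[of t] by (cases "t = 0") auto

lemma M_star_shaped:
  assumes "0 \<le> c" "c \<le> 1" "0 \<le> t"
  shows "M (c * t) \<le> c * M t"
  using convex_onD[OF Mconv, of c 0 t] assms M0 by simp

lemma M_quotient_mono:
  assumes "0 < s" "s \<le> t"
  shows "M s / s \<le> M t / t"
  using M_star_shaped[of "s / t" t] assms by (simp add: field_simps)

lemma M_mono:
  assumes "0 \<le> s" "s \<le> t"
  shows "M s \<le> M t"
proof (cases "t = 0")
  case False
  then have "M (s / t * t) \<le> (s / t) * M t"
    using assms by (intro M_star_shaped) auto
  also have "\<dots> \<le> 1 * M t"
    using assms False by (intro mult_right_mono Mnonneg) auto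
  finally show ?thesis using False by simp
qed (use assms in auto)

lemma M_double: "0 \<le> t \<Longrightarrow> 2 * M t \<le> M (2 * t)"
  using M_star_shaped[of "1/2" "2 * t"] by simp

lemma M_half_add:
  assumes "0 \<le> s" "0 \<le> t"
  shows "M ((s + t) / 2) \<le> M s + M t"
proof -
  have "M ((s + t) / 2) \<le> M (max s t)"
    using assms by (intro M_mono) auto
  also have "\<dots> \<le> M s + M t"
    using Mnonneg assms by (auto simp: max_def)
  finally show ?thesis .
qed

text \<open>Below \<open>u\<close> this is monotonicity, above \<open>u\<close> the decrease of
  \<open>M t / t powr p\<close>. Adding the two bounds gives a form that can be averaged, turning
  moments of order \<open>p\<close> into bounds for \<open>M\<close>.\<close>

lemma M_powr_bound:
  assumes "0 < u" "0 \<le> y" "0 < c"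
  shows "M (c * y) \<le> (1 + (y / u) powr p) * M (c * u)"
proof (cases "y \<le> u")
  case True
  have "M (c * y) \<le> 1 * M (c * u)"
    using assms True by (simp add: M_mono)
  also have "\<dots> \<le> (1 + (y / u) powr p) * M (c * u)"
    using assms by (intro mult_right_mono Mnonneg) auto
  finally show ?thesis .
next
  case False
  then have "M (c * y) / (c * y) powr p \<le> M (c * u) / (c * u) powr p"
    using assms by (intro monotone_onD[OF decr]) auto
  then have "M (c * y) \<le> (y / u) powr p * M (c * u)"
    using assms False by (simp add: powr_mult powr_divide field_simps)
  also have "\<dots> \<le> (1 + (y / u) powr p) * M (c * u)"
    using assms by (intro mult_right_mono Mnonneg) auto
  finally show ?thesis .
qed

lemma M_unbounded: "\<exists>t>0. c \<le> M t"
proof -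
  have "eventually (\<lambda>t. M t / t \<ge> max c 0) at_top"
    using orlicz unfolding orlicz_function_def filterlim_at_top by blast
  then have "eventually (\<lambda>t. M t / t \<ge> max c 0 \<and> t \<ge> 1) at_top"
    using eventually_ge_at_top by (rule eventually_conj)
  then obtain t where t: "M t / t \<ge> max c 0" "t \<ge> 1"
    by (metis (mono_tags, lifting) eventually_happens trivial_limit_at_top_linorder)
  have "c \<le> max c 0 * t" using t(2) by (auto simp: max_def mult_le_cancel_left1)
  also have "\<dots> \<le> M t" using t by (subst (asm) pos_le_divide_eq) auto
  finally show ?thesis using t by (intro exI[of _ t]) auto
qed


lemma M_strict_mono:
  assumes "0 \<le> s" "s < t"
  shows "M s < M t"
proof -
  have "M (s / t * t) \<le> s / t * M t"
    using assms by (intro M_star_shaped) auto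
  also have "\<dots> < 1 * M t"
    using assms by (intro mult_strict_right_mono Mpos) auto
  finally show ?thesis using assms by simp
qed

lemma M_solve:
  assumes "0 < c"
  shows "\<exists>t>0. M t = c"
proof -
  obtain b where b: "0 < b" "c \<le> M b" using M_unbounded by blast
  \<comment> \<open>The intermediate value theorem is applied from a positive left end, as
    continuity comes from convexity on the open half-line. Star-shapedness gives
    \<open>M s \<le> c\<close> for this choice.\<close>
  define s where "s = min b (b * c / M b)"
  have s: "0 < s" "s \<le> b" using b assms Mpos[of b] by (auto simp: s_def)
  have "M (s / b * b) \<le> s / b * M b"
    using s b by (intro M_star_shaped) auto
  also have "\<dots> \<le> (b * c / M b) / b * M b"
    using b Mnonneg[of b] unfolding s_def by (intro mult_right_mono divide_right_mono) auto
  finally have "M s \<le> c" using b Mpos[of b] by simp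
  moreover have "continuous_on {0<..} M"
    by (rule convex_on_continuous) (auto intro: convex_on_subset[OF Mconv])
  then have "continuous_on {s..b} M"
    by (rule continuous_on_subset) (use s in auto)
  ultimately obtain t where "s \<le> t" "M t = c"
    using IVT'[of M s c b] s b by auto
  then show ?thesis using s by (intro exI[of _ t]) auto
qed

text \<open>
  With \<open>M (t j) = j / n\<close>, the weight \<open>v j\<close> is \<open>n\<close> times the increment of \<open>M s / s\<close> from
  \<open>t (j - 1)\<close> to \<open>t j\<close>; it is at most \<open>1 / t j\<close>.
\<close>

lemma exists_weights:
  assumes n: "1 \<le> n"
  obtains v :: "nat \<Rightarrow> real" where "\<And>j. j \<in> {1..n} \<Longrightarrow> 0 \<le> v j"
    and "\<And>t. 0 \<le> t \<Longrightarrow> avg {1..n} (\<lambda>j. \<phi> (t * v j)) \<le> M t / (2 - p)"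
    and "\<And>t. 0 \<le> t \<Longrightarrow> 1 / real n \<le> M t \<Longrightarrow> min (M t) 1 \<le> 3 * avg {1..n} (\<lambda>j. \<phi> (t * v j))"
proof -
  have "\<exists>\<tau>. \<forall>j::nat. 1 \<le> j \<longrightarrow> 0 < \<tau> j \<and> M (\<tau> j) = real j / real n"
  proof (rule choice, rule allI)
    fix j :: nat
    show "\<exists>t. 1 \<le> j \<longrightarrow> 0 < t \<and> M t = real j / real n"
      using M_solve[of "real j / real n"] n by (cases "1 \<le> j") auto
  qed
  then obtain \<tau> :: "nat \<Rightarrow> real"
    where \<tau>: "\<And>j. 1 \<le> j \<Longrightarrow> 0 < \<tau> j" "\<And>j. 1 \<le> j \<Longrightarrow> M (\<tau> j) = real j / real n"
    by blast
  have \<tau>_le: "\<tau> j \<le> t" if "1 \<le> j" "real j / real n \<le> M t" "0 \<le> t" for j t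
    using M_strict_mono[of t "\<tau> j"] \<tau>[OF that(1)] that by force
  \<comment> \<open>The value 0 at \<open>j = 0\<close> makes the weights telescope to
    \<open>n * G j\<close> and gives \<open>v 1 = 1 / \<tau> 1\<close>.\<close>
  define G where "G j = (if j = 0 then 0 else M (\<tau> j) / \<tau> j)" for j
  define v where "v j = real n * (G j - G (j - 1))" for j
  have \<tau>_mono: "\<tau> i \<le> \<tau> j" if "1 \<le> i" "i \<le> j" for i j
    using that \<tau>[of j] n by (intro \<tau>_le) (auto simp: divide_right_mono)
  have G: "0 \<le> G j" "G j \<le> G (Suc j)" for j
    using M_quotient_mono[OF \<tau>(1) \<tau>_mono, of j "Suc j"] \<tau>(1)[of j] \<tau>(1)[of "Suc j"]
      Mnonneg[of "\<tau> j"] Mnonneg[of "\<tau> (Suc j)"]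
    by (auto simp: G_def)
  have nG: "real n * G j = real j / \<tau> j" if "1 \<le> j" for j
    using \<tau>(2)[OF that] that n by (simp add: G_def)
  have v0: "0 \<le> v j" if "1 \<le> j" for j
    using G(2)[of "j - 1"] that by (auto simp: v_def)
  \<comment> \<open>Since \<open>n * G j = j / \<tau> j\<close>, the weight is
    \<open>1 / \<tau> j\<close> minus \<open>(j - 1) * (1 / \<tau> (j - 1) - 1 / \<tau> j)\<close>,
    which is nonnegative.\<close>
  have v_le: "v j \<le> 1 / \<tau> j" if "1 \<le> j" for j
  proof (cases "j = 1")
    case True
    then show ?thesis using n \<tau>[of 1] by (simp add: v_def G_def)
  next
    case False
    then have "(real j - 1) / \<tau> j \<le> (real j - 1) / \<tau> (j - 1)"
      using that \<tau>(1)[of j] \<tau>(1)[of "j - 1"] \<tau>_mono[of "j - 1" j]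
      by (intro divide_left_mono mult_pos_pos) auto
    moreover have "v j = real j / \<tau> j - (real j - 1) / \<tau> (j - 1)"
      using False that nG[of j] nG[of "j - 1"]
      by (simp add: v_def right_diff_distrib of_nat_diff)
    ultimately show ?thesis by (simp add: diff_divide_distrib)
  qed
  have up: "avg {1..n} (\<lambda>j. \<phi> (t * v j)) \<le> M t / (2 - p)" if "0 \<le> t" for t
  proof (cases "t = 0")
    case True
    then show ?thesis by (simp add: avg_def \<phi>_def M0)
  next
    case False
    with that have t: "0 < t" by simp
    define s where "s = 2 - p"
    define g where "g = M t / t"
    \<comment> \<open>For \<open>j \<ge> 1\<close> this dominates the truncation
      \<open>min (t * v j) 1\<close>. The value \<open>w 0 = 1\<close> starts a summation by
      parts.\<close>
    define w where "w j = (if j = 0 then 1 else min 1 (t / \<tau> j))" for j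
    have s: "0 < s" "s < 1" using p by (auto simp: s_def)
    have g: "0 < g" using t Mpos by (simp add: g_def)
    have w: "0 < w j" "w j \<le> 1" for j
      using \<tau>(1)[of j] t by (auto simp: w_def)
    have w_mono: "w (Suc j) \<le> w j" for j
    proof (cases "j = 0")
      case False
      then have "t / \<tau> (Suc j) \<le> t / \<tau> j"
        using \<tau>(1)[of j] \<tau>_mono[of j "Suc j"] t by (intro divide_left_mono) auto
      then show ?thesis using False by (auto simp: w_def min_def)
    qed (use w in \<open>auto simp: w_def\<close>)
    \<comment> \<open>For \<open>j \<ge> 1\<close> and \<open>\<tau> j \<le> t\<close>, where
      \<open>w j = 1\<close>, this is monotonicity of \<open>M u / u\<close>; beyond
      \<open>t\<close> it is the decrease of \<open>M u / u powr p\<close>, since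
      \<open>s - 1 = - (p - 1)\<close>.\<close>
    have Gw: "G j \<le> g * w j powr (s - 1)" for j
    proof (cases "j = 0 \<or> \<tau> j \<le> t")
      case True
      then show ?thesis
        using g M_quotient_mono[of "\<tau> j" t] \<tau>(1)[of j] by (auto simp: G_def w_def g_def)
    next
      case False
      then have j: "1 \<le> j" "t < \<tau> j" by auto
      have "M (\<tau> j) / \<tau> j powr p \<le> M t / t powr p"
        using j t by (intro monotone_onD[OF decr]) auto
      then have "M (\<tau> j) / \<tau> j powr p * \<tau> j powr (p - 1) \<le> M t / t powr p * \<tau> j powr (p - 1)"
        by (intro mult_right_mono) auto
      moreover have "w j powr (s - 1) = \<tau> j powr (p - 1) / t powr (p - 1)"
      proof -
        have "w j = t / \<tau> j" using j t by (simp add: w_def min_def)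
        moreover have "s - 1 = - (p - 1)" by (simp add: s_def)
        ultimately show ?thesis
          using j t by (simp only: powr_minus powr_divide) simp
      qed
      ultimately show ?thesis
        using j t by (simp add: G_def g_def powr_diff mult_ac)
    qed
    \<comment> \<open>Summation by parts leaves the terms \<open>G j * (w j - w (Suc j))\<close>.
      With the bound for \<open>G j\<close> they are at most a lower Riemann sum of
      \<open>g * x powr (s - 1)\<close> over \<open>[w m, 1]\<close>, whose integral is the last
      summand; it stays bounded because \<open>s = 2 - p\<close> is positive.\<close>
    have S: "(\<Sum>j=1..m. (G j - G (j - 1)) * w j) \<le> G m * w m + g / s * (1 - w m powr s)" for m
    proof (induction m)
      case 0
      then show ?case by (simp add: G_def w_def)
    next
      case (Suc m)
      let ?r = "w (Suc m) / w m"
      have "?r powr s \<le> 1 - s + s * ?r"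
        using w[of m] w[of "Suc m"] s by (intro powr_le_tangent) auto
      then have "w m powr s * (s * (1 - ?r)) \<le> w m powr s * (1 - ?r powr s)"
        by (intro mult_left_mono) (auto simp: algebra_simps)
      then have "w m powr (s - 1) * (w m - w (Suc m)) \<le> (w m powr s - w (Suc m) powr s) / s"
      proof -
        have "w m powr (s - 1) * (w m - w (Suc m)) = w m powr s * (1 - ?r)"
          using w[of m] by (simp add: powr_diff field_simps)
        moreover have "w m powr s * (1 - ?r powr s) = w m powr s - w (Suc m) powr s"
          using w[of m] w[of "Suc m"] by (simp add: powr_divide field_simps)
        ultimately show ?thesis
          using s \<open>w m powr s * (s * (1 - ?r)) \<le> w m powr s * (1 - ?r powr s)\<close>
          by (simp only: pos_le_divide_eq mult_ac)
      qed
      then have "g * (w m powr (s - 1) * (w m - w (Suc m))) \<le> g * ((w m powr s - w (Suc m) powr s) / s)"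
        using g by (intro mult_left_mono) auto
      moreover have "G m * (w m - w (Suc m)) \<le> g * w m powr (s - 1) * (w m - w (Suc m))"
        using Gw[of m] w_mono[of m] by (intro mult_right_mono) auto
      ultimately have "G m * (w m - w (Suc m)) \<le> g / s * (w m powr s - w (Suc m) powr s)"
        by (simp add: mult.assoc)
      with Suc show ?case by (simp add: algebra_simps)
    qed
    have "(\<Sum>j=1..n. \<phi> (t * v j)) \<le> (\<Sum>j=1..n. (t * real n) * ((G j - G (j - 1)) * w j))"
    proof (rule sum_mono)
      fix j assume "j \<in> {1..n}"
      then have j: "1 \<le> j" by simp
      have "t * v j \<le> t * (1 / \<tau> j)" using v_le[OF j] t by (intro mult_left_mono) auto
      then have "\<phi> (t * v j) \<le> t * v j * w j"
        unfolding \<phi>_def using v0[OF j] t j by (intro mult_left_mono) (auto simp: w_def)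
      then show "\<phi> (t * v j) \<le> (t * real n) * ((G j - G (j - 1)) * w j)"
        by (simp add: v_def mult_ac)
    qed
    also have "\<dots> = (t * real n) * (\<Sum>j=1..n. (G j - G (j - 1)) * w j)"
      by (simp add: sum_distrib_left)
    also have "\<dots> \<le> (t * real n) * (g / s)"
    proof (rule mult_left_mono)
      have "G n * w n \<le> g * (w n powr (s - 1) * w n)"
        using mult_right_mono[OF Gw[of n], of "w n"] w[of n] by (simp add: mult.assoc)
      also have "w n powr (s - 1) * w n = w n powr s"
        using w[of n] by (simp add: powr_diff)
      \<comment> \<open>As \<open>s < 1\<close>, the boundary term is at most what the last summand
        of \<open>S\<close> subtracts.\<close>
      also have "g * w n powr s \<le> g / s * w n powr s"
        using g s by (intro mult_right_mono) (auto simp: field_simps)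
      finally show "(\<Sum>j=1..n. (G j - G (j - 1)) * w j) \<le> g / s"
        using S[of n] by (simp add: right_diff_distrib)
    qed (use t in auto)
    also have "\<dots> = M t / (2 - p) * real n"
      using t by (simp add: g_def s_def)
    finally show ?thesis
      using n by (simp add: avg_def pos_divide_le_eq)
  qed
  have low: "min (M t) 1 \<le> 3 * avg {1..n} (\<lambda>j. \<phi> (t * v j))" if "0 \<le> t" "1 / real n \<le> M t" for t
  proof -
    \<comment> \<open>\<open>J\<close> is the last index whose grid value \<open>J / n\<close> does
      not exceed \<open>M t\<close>; hence \<open>M t \<le> (J + 1) / n \<le> 2 * J / n\<close>
      unless \<open>J = n\<close>.\<close>
    define J where "J = Max {j \<in> {1..n}. \<tau> j \<le> t}"
    have "1 \<in> {j \<in> {1..n}. \<tau> j \<le> t}"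
      using n \<tau>_le[of 1 t] that by auto
    then have "J \<in> {j \<in> {1..n}. \<tau> j \<le> t}"
      unfolding J_def by (intro Max_in) auto
    then have J: "1 \<le> J" "J \<le> n" "\<tau> J \<le> t" by auto
    have "min (M t) 1 \<le> 2 * (real J / real n)"
    proof (cases "J = n")
      case False
      have "\<not> \<tau> (Suc J) \<le> t"
      proof
        assume "\<tau> (Suc J) \<le> t"
        with False J have "Suc J \<le> J"
          unfolding J_def[symmetric] by (subst (2) J_def, intro Max_ge) auto
        then show False by simp
      qed
      then have "M t \<le> real (Suc J) / real n"
        using M_mono[of t "\<tau> (Suc J)"] \<tau>(2)[of "Suc J"] that by simp
      also have "\<dots> \<le> 2 * (real J / real n)"
        using J n by (simp add: field_simps)
      finally show ?thesis by simp
    qed (use n in auto)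
    moreover have "3 / 4 * (real J / real n) \<le> avg {1..n} (\<lambda>j. \<phi> (t * v j))"
    proof -
      have tel: "(\<Sum>j=1..J. v j) = real n * G J"
        using sum_telescope''[of 0 J G] by (simp add: v_def sum_distrib_left[symmetric] G_def)
      \<comment> \<open>By telescoping, the numbers \<open>\<tau> J * v j\<close> with
        \<open>j \<le> J\<close> have mean 1, so subtracting 1/4 from each keeps three quarters.
        Together with the factor 2 above this gives 8/3, rounded up to 3.\<close>
      have "3 / 4 * real J = (\<Sum>j=1..J. \<tau> J * v j - 1/4)"
        using J n \<tau>[of J] tel
        by (simp add: sum_subtractf sum_distrib_left[symmetric] G_def)
      also have "\<dots> \<le> (\<Sum>j=1..J. \<phi> (\<tau> J * v j))"
      proof (rule sum_mono)
        fix j assume "j \<in> {1..J}"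
        have "s - 1/4 \<le> \<phi> s" for s :: real
          using zero_le_power2[of "s - 1/2"]
          by (auto simp: \<phi>_def min_def power2_eq_square algebra_simps)
        then show "\<tau> J * v j - 1/4 \<le> \<phi> (\<tau> J * v j)" .
      qed
      also have "\<dots> \<le> (\<Sum>j=1..J. \<phi> (t * v j))"
        using J \<tau>(1)[of J] v0 by (intro sum_mono phi_mono mult_right_mono mult_nonneg_nonneg) auto
      also have "\<dots> \<le> (\<Sum>j=1..n. \<phi> (t * v j))"
        using J v0 that by (intro sum_mono2 phi_nonneg mult_nonneg_nonneg) auto
      finally show ?thesis using n by (simp add: avg_def field_simps)
    qed
    moreover have "0 \<le> real J / real n" by simp
    ultimately show ?thesis by linarith
  qed
  show thesis using that[of v] v0 up low by simp
qed

end

section \<open>Rearrangements and random Rademacher sums\<close>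

text \<open>Sorting permutes list positions; conjugating with the shift from positions
  \<open>0..n-1\<close> to coordinates \<open>1..n\<close> gives the bijection through which later
  proofs use the rearrangement.\<close>

lemma rearr_permutation:
  "\<exists>\<tau>. bij_betw \<tau> {1..n} {1..n} \<and> (\<forall>k\<in>{1..n}. rearr n x k = \<bar>x (\<tau> k)\<bar>)"
proof -
  let ?xs = "map (\<lambda>j. \<bar>x j\<bar>) [1..<Suc n]"
  have "mset (rev (sort ?xs)) = mset ?xs" by simp
  then obtain p where p: "p permutes {..<length ?xs}" "permute_list p ?xs = rev (sort ?xs)"
    by (rule mset_eq_permutation)
  define \<tau> where "\<tau> k = Suc (p (k - 1))" for k
  have p': "p permutes {..<n}" using p by (simp del: upt_Suc)
  have "bij_betw \<tau> {1..n} {1..n}"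
  proof -
    have 1: "bij_betw (\<lambda>k. k - 1) {1..n} {..<n}"
      by (rule bij_betw_byWitness[where f' = Suc]) auto
    have 2: "bij_betw Suc {..<n} {1..n}"
      by (rule bij_betw_byWitness[where f' = "\<lambda>k. k - 1"]) auto
    show ?thesis
      using bij_betw_trans[OF bij_betw_trans[OF 1 permutes_imp_bij[OF p']] 2]
      by (simp add: \<tau>_def[abs_def] comp_def)
  qed
  moreover have "rearr n x k = \<bar>x (\<tau> k)\<bar>" if "k \<in> {1..n}" for k
  proof -
    have "rearr n x k = permute_list p ?xs ! (k - 1)"
      unfolding rearr_def p(2) ..
    also have "\<dots> = ?xs ! p (k - 1)"
      using that by (intro permute_list_nth p) auto
    also have "\<dots> = \<bar>x (\<tau> k)\<bar>"
      using that permutes_in_image[OF p', of "k - 1"]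
      by (subst nth_map) (auto simp: \<tau>_def simp del: upt_Suc)
    finally show ?thesis .
  qed
  ultimately show ?thesis by blast
qed

lemma rearr_nonneg: "k \<in> {1..n} \<Longrightarrow> 0 \<le> rearr n x k"
  using rearr_permutation[of n x] by auto

lemma rearr_antimono:
  assumes "1 \<le> i" "i \<le> j" "j \<le> n"
  shows "rearr n x j \<le> rearr n x i"
  unfolding rearr_def using assms by (intro sorted_rev_nth_mono) auto

text \<open>Applied to the head and tail averages, this lets their modulars be read in the given
  order.\<close>

lemma rearr_of_antimono:
  assumes "\<And>i j. 1 \<le> i \<Longrightarrow> i \<le> j \<Longrightarrow> j \<le> n \<Longrightarrow> u j \<le> u i"
    and "\<And>i. i \<in> {1..n} \<Longrightarrow> 0 \<le> u i" and "k \<in> {1..n}"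
  shows "rearr n u k = u k"
proof -
  let ?xs = "map (\<lambda>j. \<bar>u j\<bar>) [1..<Suc n]"
  have "sort ?xs = rev ?xs"
  proof (rule properties_for_sort)
    show "sorted (rev ?xs)"
      using assms by (auto simp: sorted_rev_iff_nth_mono simp del: upt_Suc)
  qed simp
  then have "rearr n u k = ?xs ! (k - 1)"
    unfolding rearr_def by (simp del: upt_Suc)
  also have "\<dots> = u k"
    using assms by (subst nth_map) (auto simp del: upt_Suc)
  finally show ?thesis .
qed

lemma rearr_eq_0_imp:
  assumes "rearr n x 1 = 0" "i \<in> {1..n}"
  shows "x i = 0"
proof -
  obtain \<tau> where \<tau>: "bij_betw \<tau> {1..n} {1..n}" "\<forall>k\<in>{1..n}. rearr n x k = \<bar>x (\<tau> k)\<bar>"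
    using rearr_permutation[of n x] by (elim exE conjE) (rule that)
  have "i \<in> \<tau> ` {1..n}"
    unfolding bij_betw_imp_surj_on[OF \<tau>(1)] by (rule assms(2))
  then obtain k where k: "i = \<tau> k" "k \<in> {1..n}" by (rule imageE)
  then have "\<bar>x i\<bar> \<le> 0"
    using bspec[OF \<tau>(2), of k] rearr_antimono[of 1 k n x] assms by auto
  then show ?thesis by simp
qed

section \<open>Jensen's inequality and subadditivity for powers\<close>

text \<open>Jensen's inequality for a concave power, from the tangent at the mean \<open>D\<close>.
  If the mean is 0, all terms vanish.\<close>

lemma avg_powr_le:
  assumes "finite A" "A \<noteq> {}" "\<And>a. a \<in> A \<Longrightarrow> 0 \<le> f a" "0 \<le> s" "s \<le> 1"
  shows "avg A (\<lambda>a. f a powr s) \<le> avg A f powr s"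
proof (cases "avg A f = 0")
  case True
  then have "\<forall>a\<in>A. f a = 0"
    using assms by (subst sum_nonneg_eq_0_iff[symmetric]) (auto simp: avg_def)
  then show ?thesis by (simp add: avg_def)
next
  case False
  define D where "D = avg A f"
  have D: "0 < D" using False avg_nonneg[OF assms(3)] by (simp add: D_def less_le)
  have "avg A (\<lambda>a. f a powr s) \<le> avg A (\<lambda>a. D powr s * ((1 - s) + (s / D) * f a))"
  proof (rule avg_mono)
    fix a assume "a \<in> A"
    then have "D powr s * (f a / D) powr s \<le> D powr s * (1 - s + s * (f a / D))"
      using assms D by (intro mult_left_mono powr_le_tangent) auto
    then show "f a powr s \<le> D powr s * ((1 - s) + (s / D) * f a)"
      using D assms(3)[OF \<open>a \<in> A\<close>] by (simp add: powr_divide)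
  qed
  also have "\<dots> = D powr s * ((1 - s) + (s / D) * D)"
    by (simp only: avg_cmult avg_add avg_const[OF assms(1,2)] D_def)
  also have "\<dots> = D powr s" using D by simp
  finally show ?thesis by (simp add: D_def)
qed

lemma avg_abs_le_sqrt:
  assumes "finite A" "A \<noteq> {}"
  shows "avg A (\<lambda>a. \<bar>f a\<bar>) \<le> sqrt (avg A (\<lambda>a. (f a)\<^sup>2))"
  using avg_powr_le[OF assms, of "\<lambda>a. (f a)\<^sup>2" "1/2"]
  by (simp add: powr_half_sqrt avg_nonneg)

text \<open>After division by the total \<open>T\<close> the terms lie in [0,1], where a power with
  exponent at most 1 does not decrease them.\<close>

lemma sum_powr_le:
  fixes f :: "'a \<Rightarrow> real"
  assumes "finite A" "\<And>a. a \<in> A \<Longrightarrow> 0 \<le> f a" "0 < s" "s \<le> 1"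
  shows "(\<Sum>a\<in>A. f a) powr s \<le> (\<Sum>a\<in>A. f a powr s)"
proof (cases "(\<Sum>a\<in>A. f a) = 0")
  case True
  have "0 \<le> (\<Sum>a\<in>A. f a powr s)" by (intro sum_nonneg) auto
  then show ?thesis using True by simp
next
  case False
  define T where "T = (\<Sum>a\<in>A. f a)"
  have T: "0 < T" using False sum_nonneg[of A f] assms(2) by (simp add: T_def less_le)
  have "T powr s = T powr s * (\<Sum>a\<in>A. f a / T)"
    using T by (simp add: T_def[symmetric] sum_divide_distrib[symmetric])
  also have "\<dots> = (\<Sum>a\<in>A. T powr s * (f a / T))"
    by (simp add: sum_distrib_left)
  also have "\<dots> \<le> (\<Sum>a\<in>A. f a powr s)"
  proof (rule sum_mono)
    fix a assume a: "a \<in> A"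
    have "f a \<le> T" unfolding T_def using assms a by (intro member_le_sum) auto
    then have "(f a / T) powr 1 \<le> (f a / T) powr s"
      using assms a T by (intro powr_mono') auto
    then have "T powr s * (f a / T) \<le> T powr s * (f a / T) powr s"
      using assms(2)[OF a] T by (intro mult_left_mono) auto
    then show "T powr s * (f a / T) \<le> f a powr s"
      using assms(2)[OF a] T by (simp add: powr_divide)
  qed
  finally show ?thesis by (simp add: T_def)
qed

lemma avg_Times: "avg (A \<times> B) F = avg A (\<lambda>a. avg B (\<lambda>b. F (a, b)))"
  unfolding avg_def
  by (simp add: sum.cartesian_product card_cartesian_product sum_divide_distrib mult.commute)

text \<open>The average is \<open>(n div k) / n\<close>; since \<open>1 \<le> k \<le> n\<close>,
  rounding down loses at most a factor 2.\<close>

lemma avg_mult_of_bool_div: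
  assumes "k \<in> {1..n}"
  shows "avg {1..n} (\<lambda>j. of_bool (k * j \<le> n)) \<le> 1 / real k"
    and "1 / (2 * real k) \<le> avg {1..n} (\<lambda>j. of_bool (k * j \<le> n))"
proof -
  have k: "0 < k" "k \<le> n" using assms by auto
  have "{j \<in> {1..n}. k * j \<le> n} = {1..n div k}"
  proof -
    have "k * j \<le> n \<longleftrightarrow> j \<le> n div k" for j
      using k by (simp add: less_eq_div_iff_mult_less_eq mult.commute)
    moreover have "n div k \<le> n" by simp
    ultimately show ?thesis by (auto intro: order_trans)
  qed
  moreover have "(\<Sum>j\<in>{1..n}. of_bool (k * j \<le> n) :: real) = real (card {j \<in> {1..n}. k * j \<le> n})"
    by (simp add: of_bool_def sum.If_cases Int_def)
  ultimately have eq: "avg {1..n} (\<lambda>j. of_bool (k * j \<le> n)) = real (n div k) / real n"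
    by (simp add: avg_def)
  have "n div k * k \<le> n" by simp
  then have "real (n div k) * real k \<le> real n"
    by (simp only: of_nat_mult[symmetric] of_nat_le_iff)
  then show "avg {1..n} (\<lambda>j. of_bool (k * j \<le> n)) \<le> 1 / real k"
    using k unfolding eq by (simp add: field_simps)
  have "n mod k \<le> k * (n div k)"
  proof -
    have "1 \<le> n div k" using k div_greater_zero_iff[of n k] by linarith
    then have "k * 1 \<le> k * (n div k)" by (rule mult_le_mono2)
    then show ?thesis using mod_less_divisor[of k n] k by linarith
  qed
  then have "n \<le> 2 * (n div k * k)"
    using mult_div_mod_eq[of k n] mult.commute[of k "n div k"] by linarith
  then have "real n \<le> 2 * (real (n div k) * real k)"
    by (metis of_nat_le_iff of_nat_mult of_nat_numeral)
  then show "1 / (2 * real k) \<le> avg {1..n} (\<lambda>j. of_bool (k * j \<le> n))"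
    using k unfolding eq by (simp add: field_simps)
qed

section \<open>Moments of Rademacher sums over random sets\<close>

abbreviation perms :: "nat \<Rightarrow> (nat \<Rightarrow> nat) set"
  where "perms n \<equiv> {\<pi>. \<pi> permutes {1..n}}"

abbreviation signs :: "nat \<Rightarrow> (nat \<Rightarrow> int) set"
  where "signs n \<equiv> {1..n} \<rightarrow>\<^sub>E {-1, 1}"

lemma finite_perms [simp]: "finite (perms n)" and perms_ne [simp]: "perms n \<noteq> {}"
  and finite_signs [simp]: "finite (signs n)" and signs_ne [simp]: "signs n \<noteq> {}"
  by (auto simp: finite_permutations finite_PiE PiE_eq_empty_iff intro: permutes_id)

text \<open>The sum \<open>f\<^sub>k(x)\<close> of the overview, with \<open>\<omega>\<close> the
  pair of a permutation and a sign vector.\<close>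

definition rsum :: "nat \<Rightarrow> (nat \<Rightarrow> real) \<Rightarrow> nat \<Rightarrow> (nat \<Rightarrow> nat) \<times> (nat \<Rightarrow> int) \<Rightarrow> real"
  where "rsum n x k \<omega> = (\<Sum>i=1..n. real_of_int (snd \<omega> i) * (of_bool (k * fst \<omega> i \<le> n) * x i))"

lemma rsum_add: "rsum n (\<lambda>i. x i + y i) k \<omega> = rsum n x k \<omega> + rsum n y k \<omega>"
  by (simp add: rsum_def distrib_left sum.distrib)

lemma rsum_cmult: "rsum n (\<lambda>i. c * x i) k \<omega> = c * rsum n x k \<omega>"
  by (simp add: rsum_def sum_distrib_left mult_ac)

lemma avg_of_bool_perm:
  assumes "i \<in> {1..n}"
  shows "avg (perms n) (\<lambda>\<pi>. of_bool (k * \<pi> i \<le> n)) = avg {1..n} (\<lambda>j. of_bool (k * j \<le> n))"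
  using avg_permutes_apply[of "{1..n}" i "\<lambda>j. of_bool (k * j \<le> n)"] assms by simp

text \<open>Averaging over signs leaves the diagonal, and each coordinate is selected with
  probability at most \<open>1 / k\<close>.\<close>

lemma rsum_square_moment:
  assumes k: "k \<in> {1..n}"
  shows "avg (perms n \<times> signs n) (\<lambda>\<omega>. (rsum n x k \<omega>)\<^sup>2) \<le> 1 / real k * (\<Sum>i=1..n. (x i)\<^sup>2)"
proof -
  have "avg (perms n \<times> signs n) (\<lambda>\<omega>. (rsum n x k \<omega>)\<^sup>2)
      = avg (perms n) (\<lambda>\<pi>. \<Sum>i=1..n. (x i)\<^sup>2 * of_bool (k * \<pi> i \<le> n))"
    unfolding avg_Times rsum_def fst_conv snd_conv
    by (subst rademacher_moments) (simp, intro avg_cong sum.cong refl, simp)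
  also have "\<dots> = (\<Sum>i=1..n. (x i)\<^sup>2 * avg {1..n} (\<lambda>j. of_bool (k * j \<le> n)))"
    unfolding avg_sum avg_cmult by (intro sum.cong refl arg_cong2[where f = "(*)"] avg_of_bool_perm)
  also have "\<dots> \<le> (\<Sum>i=1..n. (x i)\<^sup>2 * (1 / real k))"
    using avg_mult_of_bool_div(1)[OF k] by (intro sum_mono mult_left_mono) auto
  finally show ?thesis by (simp add: sum_distrib_left)
qed

text \<open>For a fixed permutation, Jensen with exponent \<open>p / 2 < 1\<close> passes to the
  second moment, and subadditivity of the same power separates the coordinates.\<close>

lemma rsum_powr_moment:
  assumes k: "k \<in> {1..n}" and p: "1 < p" "p < 2"
  shows "avg (perms n \<times> signs n) (\<lambda>\<omega>. \<bar>rsum n x k \<omega>\<bar> powr p)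
    \<le> 1 / real k * (\<Sum>i=1..n. \<bar>x i\<bar> powr p)"
proof -
  have sq: "(z\<^sup>2) powr (p/2) = \<bar>z\<bar> powr p" for z :: real
  proof -
    have "z\<^sup>2 = \<bar>z\<bar> powr 2" by (cases "z = 0") (auto simp: powr_numeral)
    then have "(z\<^sup>2) powr (p/2) = (\<bar>z\<bar> powr 2) powr (p/2)" by (simp only:)
    also have "\<dots> = \<bar>z\<bar> powr (2 * (p/2))" by (rule powr_powr)
    finally show ?thesis by simp
  qed
  have "avg (perms n \<times> signs n) (\<lambda>\<omega>. \<bar>rsum n x k \<omega>\<bar> powr p)
      \<le> avg (perms n) (\<lambda>\<pi>. \<Sum>i=1..n. \<bar>x i\<bar> powr p * of_bool (k * \<pi> i \<le> n))"
    unfolding avg_Times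
  proof (rule avg_mono)
    fix \<pi>
    let ?c = "\<lambda>i. of_bool (k * \<pi> i \<le> n) * x i"
    have "avg (signs n) (\<lambda>\<epsilon>. \<bar>rsum n x k (\<pi>, \<epsilon>)\<bar> powr p)
        = avg (signs n) (\<lambda>\<epsilon>. ((\<Sum>i=1..n. real_of_int (\<epsilon> i) * ?c i)\<^sup>2) powr (p/2))"
      by (simp add: rsum_def sq)
    also have "\<dots> \<le> (avg (signs n) (\<lambda>\<epsilon>. (\<Sum>i=1..n. real_of_int (\<epsilon> i) * ?c i)\<^sup>2)) powr (p/2)"
      using p by (intro avg_powr_le finite_signs signs_ne) auto
    also have "\<dots> = (\<Sum>i=1..n. (?c i)\<^sup>2) powr (p/2)"
      by (subst rademacher_moments) auto
    also have "\<dots> \<le> (\<Sum>i=1..n. ((?c i)\<^sup>2) powr (p/2))"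
      using p by (intro sum_powr_le) auto
    also have "\<dots> = (\<Sum>i=1..n. \<bar>x i\<bar> powr p * of_bool (k * \<pi> i \<le> n))"
      unfolding sq by (intro sum.cong) auto
    finally show "avg (signs n) (\<lambda>\<epsilon>. \<bar>rsum n x k (\<pi>, \<epsilon>)\<bar> powr p)
      \<le> (\<Sum>i=1..n. \<bar>x i\<bar> powr p * of_bool (k * \<pi> i \<le> n))" .
  qed
  also have "\<dots> = (\<Sum>i=1..n. \<bar>x i\<bar> powr p * avg {1..n} (\<lambda>j. of_bool (k * j \<le> n)))"
    unfolding avg_sum avg_cmult by (intro sum.cong refl arg_cong2[where f = "(*)"] avg_of_bool_perm)
  also have "\<dots> \<le> (\<Sum>i=1..n. \<bar>x i\<bar> powr p * (1 / real k))"
    using avg_mult_of_bool_div(1)[OF k] by (intro sum_mono mult_left_mono) auto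
  finally show ?thesis by (simp add: sum_distrib_left)
qed

text \<open>The \<open>k\<close> largest coordinates, indexed by \<open>B\<close>, have modulus at
  least \<open>r\<close>, and each is selected with probability at least \<open>1 / (2 * k)\<close>,
  so at least 1/2 of one is expected. This bounds the square function from below; Khintchine's
  inequality adds the factor \<open>1 / sqrt 3\<close>.\<close>

lemma rsum_abs_ge:
  assumes k: "k \<in> {1..n}"
  shows "rearr n x k / (2 * sqrt 6) \<le> avg (perms n \<times> signs n) (\<lambda>\<omega>. \<bar>rsum n x k \<omega>\<bar>)"
proof -
  obtain \<tau> where \<tau>: "bij_betw \<tau> {1..n} {1..n}" "\<forall>j\<in>{1..n}. rearr n x j = \<bar>x (\<tau> j)\<bar>"
    using rearr_permutation[of n x] by (elim exE conjE) (rule that)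
  define B where "B = \<tau> ` {1..k}"
  define z :: "nat \<Rightarrow> real" where "z i = of_bool (i \<in> B)" for i
  define w :: "nat \<Rightarrow> real" where "w j = of_bool (k * j \<le> n)" for j
  define r where "r = rearr n x k"
  have r0: "0 \<le> r" using rearr_nonneg[OF k] by (simp add: r_def)
  have B: "B \<subseteq> {1..n}" "card B = k"
  proof -
    have "{1..k} \<subseteq> {1..n}" using k by auto
    then show "B \<subseteq> {1..n}" "card B = k"
      using \<tau>(1) unfolding B_def bij_betw_def
      by (auto simp: card_image inj_on_subset)
  qed
  have xB: "r \<le> \<bar>x i\<bar>" if i: "i \<in> B" for i
  proof -
    obtain j where "j \<in> {1..k}" "i = \<tau> j" using i unfolding B_def by blast
    then show ?thesis using rearr_antimono[of j k n x] bspec[OF \<tau>(2), of j] k by (simp add: r_def)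
  qed
  have "1/2 \<le> real k * avg {1..n} w"
    using avg_mult_of_bool_div(2)[OF k] k by (simp add: w_def[abs_def] field_simps)
  also have "\<dots> = (\<Sum>i\<in>{1..n}. z i * avg {1..n} w)"
    using B finite_subset[OF B(1)]
    by (simp add: z_def of_bool_def sum.If_cases sum_distrib_right[symmetric] Int_absorb1)
  also have "\<dots> = (\<Sum>i\<in>{1..n}. avg {1..n} (\<lambda>j. \<phi> (z i * w j)))"
    unfolding avg_cmult[symmetric] by (intro sum.cong avg_cong) (auto simp: z_def w_def \<phi>_def)
  finally have q: "1/2 \<le> (\<Sum>i\<in>{1..n}. avg {1..n} (\<lambda>j. \<phi> (z i * w j)))" .
  have "(1/2) / sqrt (1 + 2 * (1/2)) \<le> avg (perms n) (\<lambda>\<pi>. sqrt (\<Sum>i\<in>{1..n}. (z i * w (\<pi> i))\<^sup>2))"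
    by (rule avg_permutes_sqrt_ge) (use q in \<open>auto simp: z_def w_def\<close>)
  then have "r / sqrt 3 * ((1/2) / sqrt 2) \<le> r / sqrt 3 * avg (perms n) (\<lambda>\<pi>. sqrt (\<Sum>i\<in>{1..n}. (z i * w (\<pi> i))\<^sup>2))"
    using r0 by (intro mult_left_mono) auto
  also have "\<dots> = avg (perms n) (\<lambda>\<pi>. r / sqrt 3 * sqrt (\<Sum>i\<in>{1..n}. (z i * w (\<pi> i))\<^sup>2))"
    by (simp only: avg_cmult)
  also have "\<dots> \<le> avg (perms n) (\<lambda>\<pi>. avg (signs n) (\<lambda>\<epsilon>. \<bar>rsum n x k (\<pi>, \<epsilon>)\<bar>))"
  proof (rule avg_mono)
    fix \<pi>
    let ?c = "\<lambda>i. of_bool (k * \<pi> i \<le> n) * x i"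
    have "r\<^sup>2 * (\<Sum>i\<in>{1..n}. (z i * w (\<pi> i))\<^sup>2) \<le> (\<Sum>i=1..n. (?c i)\<^sup>2)"
      unfolding sum_distrib_left
    proof (rule sum_mono)
      fix i
      have "r\<^sup>2 \<le> (x i)\<^sup>2" if "i \<in> B"
        using power_mono[OF xB[OF that] r0, of 2] by simp
      then show "r\<^sup>2 * (z i * w (\<pi> i))\<^sup>2 \<le> (?c i)\<^sup>2"
        by (auto simp: z_def w_def)
    qed
    then have "sqrt (r\<^sup>2 * (\<Sum>i\<in>{1..n}. (z i * w (\<pi> i))\<^sup>2)) / sqrt 3 \<le> sqrt (\<Sum>i=1..n. (?c i)\<^sup>2) / sqrt 3"
      by (intro divide_right_mono) auto
    also have "\<dots> \<le> avg (signs n) (\<lambda>\<epsilon>. \<bar>rsum n x k (\<pi>, \<epsilon>)\<bar>)"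
      unfolding rsum_def fst_conv snd_conv by (intro khintchine_lower) auto
    finally show "r / sqrt 3 * sqrt (\<Sum>i\<in>{1..n}. (z i * w (\<pi> i))\<^sup>2)
        \<le> avg (signs n) (\<lambda>\<epsilon>. \<bar>rsum n x k (\<pi>, \<epsilon>)\<bar>)"
      using r0 by (simp add: real_sqrt_mult)
  qed
  also have "r / sqrt 3 * ((1/2) / sqrt 2) = r / (2 * sqrt 6)"
    by (simp add: real_sqrt_mult[symmetric])
  finally show ?thesis unfolding avg_Times r_def .
qed

section \<open>The embedding\<close>

text \<open>Averaging \<open>M_powr_bound\<close> yields two copies of \<open>M (c * u)\<close> at
  most. For \<open>u = 0\<close> the moment bound forces \<open>Y\<close> to vanish on
  \<open>\<Omega>\<close>.\<close>

lemma (in p_orlicz) avg_M_le_powr: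
  assumes "finite \<Omega>" "\<Omega> \<noteq> {}" "\<And>\<omega>. 0 \<le> Y \<omega>" "0 \<le> u" "0 < c"
    and mom: "avg \<Omega> (\<lambda>\<omega>. Y \<omega> powr p) \<le> u powr p"
  shows "avg \<Omega> (\<lambda>\<omega>. M (c * Y \<omega>)) \<le> 2 * M (c * u)"
proof (cases "u = 0")
  case True
  have "avg \<Omega> (\<lambda>\<omega>. Y \<omega> powr p) = 0"
    using mom True by (intro antisym avg_nonneg) auto
  then have "\<forall>\<omega>\<in>\<Omega>. Y \<omega> powr p = 0"
    using assms(1,2) by (subst sum_nonneg_eq_0_iff[symmetric]) (auto simp: avg_def)
  then show ?thesis using True M0 by (simp add: avg_def)
next
  case False
  with assms have u: "0 < u" by simp
  have "avg \<Omega> (\<lambda>\<omega>. M (c * Y \<omega>)) \<le> avg \<Omega> (\<lambda>\<omega>. M (c * u) * (1 + Y \<omega> powr p / u powr p))"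
  proof (rule avg_mono)
    fix \<omega>
    show "M (c * Y \<omega>) \<le> M (c * u) * (1 + Y \<omega> powr p / u powr p)"
      using M_powr_bound[OF u assms(3,5), of \<omega>] assms(3)[of \<omega>] u
      by (simp add: powr_divide mult.commute)
  qed
  also have "\<dots> = M (c * u) * (1 + avg \<Omega> (\<lambda>\<omega>. Y \<omega> powr p) / u powr p)"
    by (simp only: avg_cmult avg_add avg_const[OF assms(1,2)] avg_divide)
  also have "\<dots> \<le> M (c * u) * (1 + 1)"
    using mom u assms(5) by (intro mult_left_mono add_left_mono Mnonneg) auto
  finally show ?thesis by simp
qed

text \<open>As \<open>p < 2\<close>, Jensen's inequality turns the bound on the second moment into
  one on the moment of order \<open>p\<close>.\<close>

lemma (in p_orlicz) avg_M_le_square: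
  assumes "finite \<Omega>" "\<Omega> \<noteq> {}" "\<And>\<omega>. 0 \<le> Y \<omega>" "0 \<le> u" "0 < c"
    and mom: "avg \<Omega> (\<lambda>\<omega>. (Y \<omega>)\<^sup>2) \<le> u\<^sup>2"
  shows "avg \<Omega> (\<lambda>\<omega>. M (c * Y \<omega>)) \<le> 2 * M (c * u)"
proof (rule avg_M_le_powr[OF assms(1-5)])
  have sq: "(z\<^sup>2) powr (p/2) = z powr p" if "0 \<le> z" for z :: real
    using that by (cases "z = 0") (auto simp: powr_powr simp flip: powr_numeral)
  have "avg \<Omega> (\<lambda>\<omega>. Y \<omega> powr p) = avg \<Omega> (\<lambda>\<omega>. ((Y \<omega>)\<^sup>2) powr (p/2))"
    by (simp add: sq assms)
  also have "\<dots> \<le> (avg \<Omega> (\<lambda>\<omega>. (Y \<omega>)\<^sup>2)) powr (p/2)"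
    using p assms by (intro avg_powr_le) auto
  also have "\<dots> \<le> (u\<^sup>2) powr (p/2)"
    using p mom by (intro powr_mono2 avg_nonneg) auto
  finally show "avg \<Omega> (\<lambda>\<omega>. Y \<omega> powr p) \<le> u powr p"
    by (simp add: sq assms)
qed

text \<open>The third permutation is not needed: the coordinates are constant in \<open>\<eta>\<close>.\<close>

definition embedding ::
    "nat \<Rightarrow> (nat \<Rightarrow> real) \<Rightarrow> (nat \<Rightarrow> real) \<Rightarrow> (nat \<Rightarrow> real) \<Rightarrow> l1_index \<Rightarrow> real"
  where "embedding n v a x = (\<lambda>(\<pi>, \<sigma>, \<eta>, \<epsilon>, \<delta>).
    if (\<pi>, \<sigma>, \<eta>, \<epsilon>, \<delta>) \<in> l1_indices n
    then \<Sum>k=1..n. real_of_int (\<delta> k) * (v (\<sigma> k) * a k * rsum n x k (\<pi>, \<epsilon>)) else 0)"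

lemma embedding_in_coord_space: "embedding n v a x \<in> coord_space (l1_indices n)"
  by (auto simp: embedding_def coord_space_def split: prod.splits)

lemma linear_embedding: "linear (embedding n v a)"
proof (rule linearI)
  fix x y
  show "embedding n v a (x + y) = embedding n v a x + embedding n v a y"
    by (auto simp: embedding_def fun_eq_iff plus_fun_def rsum_add[unfolded plus_fun_def]
        distrib_left sum.distrib)
next
  fix c x
  show "embedding n v a (c *\<^sub>R x) = c *\<^sub>R embedding n v a x"
    by (auto simp: embedding_def fun_eq_iff scaleR_fun_def rsum_cmult sum_distrib_left mult_ac)
qed

lemma l1_norm_eq_avg: "l1_norm n x = avg (l1_indices n) (\<lambda>t. \<bar>x t\<bar>)"
proof -
  have "real (card (l1_indices n)) = fact n ^ 3 * 2 ^ (2 * n)"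
    unfolding l1_indices_def
    by (simp add: card_cartesian_product card_permutations[of "{1..n}" n] card_PiE
        power3_eq_cube mult_2 power_add del: One_nat_def)
  then show ?thesis by (simp add: l1_norm_def avg_def)
qed

text \<open>The average over \<open>\<eta>\<close> is that of a constant; the others are reordered
  to put \<open>\<omega> = (\<pi>, \<epsilon>)\<close> outermost, the only variable entering
  \<open>rsum\<close>.\<close>

lemma l1_norm_embedding:
  "l1_norm n (embedding n v a x) = avg (perms n \<times> signs n) (\<lambda>\<omega>. avg (perms n) (\<lambda>\<sigma>.
    avg (signs n) (\<lambda>\<delta>. \<bar>\<Sum>k=1..n. real_of_int (\<delta> k) * (v (\<sigma> k) * a k * rsum n x k \<omega>)\<bar>)))"
proof -
  let ?F = "\<lambda>\<pi> \<sigma> \<epsilon> \<delta>. \<bar>\<Sum>k=1..n. real_of_int (\<delta> k) * (v (\<sigma> k) * a k * rsum n x k (\<pi>, \<epsilon>))\<bar>"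
  have "l1_norm n (embedding n v a x)
      = avg (l1_indices n) (\<lambda>t. ?F (fst t) (fst (snd t)) (fst (snd (snd (snd t)))) (snd (snd (snd (snd t)))))"
    unfolding l1_norm_eq_avg by (intro avg_cong) (auto simp: embedding_def split: prod.splits)
  also have "\<dots> = avg (perms n) (\<lambda>\<pi>. avg (perms n) (\<lambda>\<sigma>. avg (perms n) (\<lambda>\<eta>.
      avg (signs n) (\<lambda>\<epsilon>. avg (signs n) (\<lambda>\<delta>. ?F \<pi> \<sigma> \<epsilon> \<delta>)))))"
    unfolding l1_indices_def avg_Times by simp
  also have "\<dots> = avg (perms n) (\<lambda>\<pi>. avg (perms n) (\<lambda>\<sigma>.
      avg (signs n) (\<lambda>\<epsilon>. avg (signs n) (\<lambda>\<delta>. ?F \<pi> \<sigma> \<epsilon> \<delta>))))"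
    by (simp only: avg_const[OF finite_perms perms_ne])
  also have "\<dots> = avg (perms n) (\<lambda>\<pi>. avg (signs n) (\<lambda>\<epsilon>. avg (perms n) (\<lambda>\<sigma>.
      avg (signs n) (\<lambda>\<delta>. ?F \<pi> \<sigma> \<epsilon> \<delta>))))"
    by (subst (2) avg_swap) (rule refl)
  finally show ?thesis by (simp only: avg_Times)
qed

section \<open>The Orlicz-Lorentz norm and its modular\<close>

lemma orlicz_lorentz_set_bdd: "bdd_below {\<rho>::real. \<rho> > 0 \<and> P \<rho>}"
  by (rule bdd_belowI[of _ 0]) auto

context p_orlicz
begin

lemma orlicz_lorentz_set_ne:
  assumes a: "\<And>i. i \<in> {1..n} \<Longrightarrow> 0 < a i"
  shows "{\<rho>. \<rho> > 0 \<and> (\<Sum>i=1..n. M (a i * rearr n x i / \<rho>)) \<le> 1} \<noteq> {}"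
proof -
  define c where "c i = a i * rearr n x i" for i
  have c: "0 \<le> c i" if "i \<in> {1..n}" for i
    unfolding c_def using a[OF that] rearr_nonneg[OF that] by simp
  \<comment> \<open>By star-shapedness, dividing the arguments by \<open>\<rho> \<ge> 1\<close>
    divides the modular by at least \<open>\<rho>\<close>.\<close>
  define \<rho> where "\<rho> = max 1 (\<Sum>i=1..n. M (c i))"
  have "(\<Sum>i=1..n. M (c i / \<rho>)) \<le> (\<Sum>i=1..n. M (c i) / \<rho>)"
  proof (rule sum_mono)
    fix i assume "i \<in> {1..n}"
    then show "M (c i / \<rho>) \<le> M (c i) / \<rho>"
      using M_star_shaped[of "1 / \<rho>" "c i"] c by (simp add: \<rho>_def)
  qed
  also have "\<dots> \<le> 1"
    by (simp add: sum_divide_distrib[symmetric] \<rho>_def)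
  finally show ?thesis
    unfolding c_def by (auto intro!: exI[of _ \<rho>] simp: \<rho>_def)
qed

lemma orlicz_lorentz_norm_nonneg:
  assumes "\<And>i. i \<in> {1..n} \<Longrightarrow> 0 < a i"
  shows "0 \<le> orlicz_lorentz_norm n M a x"
  unfolding orlicz_lorentz_norm_def
  using orlicz_lorentz_set_ne[OF assms] by (intro cInf_greatest) auto

text \<open>The strict inequality provides an admissible \<open>r < \<rho>\<close> whether or not
  the infimum is attained, and the modular decreases in \<open>\<rho>\<close>.\<close>

lemma modular_le_1:
  assumes a: "\<And>i. i \<in> {1..n} \<Longrightarrow> 0 < a i" and less: "orlicz_lorentz_norm n M a x < \<rho>"
  shows "(\<Sum>i=1..n. M (a i * rearr n x i / \<rho>)) \<le> 1"
proof -
  obtain r where r: "0 < r" "r < \<rho>" "(\<Sum>i=1..n. M (a i * rearr n x i / r)) \<le> 1"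
    using cInf_lessD[OF orlicz_lorentz_set_ne[OF a] less[unfolded orlicz_lorentz_norm_def]] by blast
  have "(\<Sum>i=1..n. M (a i * rearr n x i / \<rho>)) \<le> (\<Sum>i=1..n. M (a i * rearr n x i / r))"
  proof (rule sum_mono)
    fix i assume i: "i \<in> {1..n}"
    have "0 \<le> a i * rearr n x i" using a[OF i] rearr_nonneg[OF i] by simp
    then show "M (a i * rearr n x i / \<rho>) \<le> M (a i * rearr n x i / r)"
      using r by (intro M_mono divide_left_mono) auto
  qed
  with r show ?thesis by simp
qed

lemma modular_gt_1:
  assumes "0 < \<rho>" "\<rho> < orlicz_lorentz_norm n M a x"
  shows "1 < (\<Sum>i=1..n. M (a i * rearr n x i / \<rho>))"
proof (rule ccontr)
  assume "\<not> ?thesis"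
  with assms(1) have "orlicz_lorentz_norm n M a x \<le> \<rho>"
    unfolding orlicz_lorentz_norm_def by (intro cInf_lower orlicz_lorentz_set_bdd) auto
  with assms(2) show False by simp
qed

lemma orlicz_lorentz_norm_eq_0:
  assumes a: "\<And>i. i \<in> {1..n} \<Longrightarrow> 0 < a i" and "orlicz_lorentz_norm n M a x = 0" "i \<in> {1..n}"
  shows "x i = 0"
proof (rule ccontr)
  assume "x i \<noteq> 0"
  have 1: "1 \<in> {1..n}" using assms(3) by auto
  define y where "y = a 1 * rearr n x 1"
  have y: "0 < y"
    using rearr_eq_0_imp[of n x i] \<open>x i \<noteq> 0\<close> assms(3) rearr_nonneg[OF 1, of x] a[OF 1]
    by (auto simp: y_def less_le)
  \<comment> \<open>If the largest entry were positive, the scale \<open>y / t\<close> would make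
    its single term \<open>M t \<ge> 2\<close>, although every positive scale has modular at most
    1.\<close>
  obtain t where t: "0 < t" "2 \<le> M t" using M_unbounded by blast
  have sum: "(\<Sum>i=1..n. M (a i * rearr n x i / (y / t))) \<le> 1"
    using y t assms(2) by (intro modular_le_1 a) auto
  have "M (a 1 * rearr n x 1 / (y / t)) \<le> (\<Sum>i=1..n. M (a i * rearr n x i / (y / t)))"
  proof (rule member_le_sum)
    fix i assume "i \<in> {1..n} - {1}"
    then have "0 < a i" "0 \<le> rearr n x i" by (auto intro: a rearr_nonneg)
    then show "0 \<le> M (a i * rearr n x i / (y / t))"
      using y t by (intro Mnonneg) auto
  qed (use 1 in auto)
  also note sum
  finally have "M (y / (y / t)) \<le> 1" by (simp only: y_def)
  then show False using t y by simp
qed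

lemma orlicz_lorentz_norm_0: "orlicz_lorentz_norm n M a (\<lambda>_. 0) = 0"
proof -
  have "rearr n (\<lambda>_. 0) i = 0" if "i \<in> {1..n}" for i
    using that by (intro rearr_of_antimono) auto
  then have "orlicz_lorentz_norm n M a (\<lambda>_. 0) = Inf {0<..}"
    unfolding orlicz_lorentz_norm_def by (simp add: M0 greaterThan_def)
  then show ?thesis by simp
qed

end

section \<open>Two-sided norm estimate for the embedding\<close>

locale orlicz_embedding = p_orlicz +
  fixes n :: nat and v a :: "nat \<Rightarrow> real"
  assumes n: "1 \<le> n"
    and a: "\<And>i. i \<in> {1..n} \<Longrightarrow> 0 < a i"
    and v: "\<And>j. j \<in> {1..n} \<Longrightarrow> 0 \<le> v j"
    and v_upper: "\<And>t. 0 \<le> t \<Longrightarrow> avg {1..n} (\<lambda>j. \<phi> (t * v j)) \<le> M t / (2 - p)"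
    and v_lower: "\<And>t. 0 \<le> t \<Longrightarrow> 1 / real n \<le> M t \<Longrightarrow> min (M t) 1 \<le> 3 * avg {1..n} (\<lambda>j. \<phi> (t * v j))"
begin

abbreviation "T \<equiv> embedding n v a"
abbreviation "\<Omega> \<equiv> perms n \<times> signs n"

lemma finite_\<Omega>: "finite \<Omega>"
  by (intro finite_cartesian_product finite_perms finite_signs)

lemma \<Omega>_ne: "\<Omega> \<noteq> {}"
  using perms_ne[of n] signs_ne[of n] by blast

lemma v_perm: "\<sigma> \<in> perms n \<Longrightarrow> k \<in> {1..n} \<Longrightarrow> 0 \<le> v (\<sigma> k)"
  using permutes_in_image[of \<sigma> "{1..n}" k] by (intro v) auto

text \<open>For fixed \<open>\<omega>\<close> and \<open>\<sigma>\<close>, averaging over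
  \<open>\<delta>\<close> is bounded by a Euclidean norm, which after scaling by \<open>r\<close> is
  at most 1/2 plus a sum of \<phi>. The average over \<open>\<sigma>\<close> and
  \<open>v_upper\<close> turn \<phi> into \<open>M\<close>. The scale \<open>r\<close> is chosen
  later.\<close>

lemma l1_norm_le_phi:
  assumes r: "0 < r"
  shows "l1_norm n (T x)
    \<le> r * (1/2 + (\<Sum>k=1..n. avg \<Omega> (\<lambda>\<omega>. M (a k * \<bar>rsum n x k \<omega>\<bar> / r))) / (2 - p))"
proof -
  let ?y = "\<lambda>\<omega> k. a k * \<bar>rsum n x k \<omega>\<bar> / r"
  have y: "0 \<le> ?y \<omega> k" if "k \<in> {1..n}" for \<omega> k
    using a[OF that] r by simp
  have "l1_norm n (T x) \<le> avg \<Omega> (\<lambda>\<omega>. r * (1/2 + (\<Sum>k=1..n. M (?y \<omega> k) / (2 - p))))"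
    unfolding l1_norm_embedding
  proof (rule avg_mono)
    fix \<omega>
    have "avg (perms n) (\<lambda>\<sigma>. avg (signs n) (\<lambda>\<delta>. \<bar>\<Sum>k=1..n. real_of_int (\<delta> k) * (v (\<sigma> k) * a k * rsum n x k \<omega>)\<bar>))
        \<le> avg (perms n) (\<lambda>\<sigma>. r * (1/2 + (\<Sum>k=1..n. \<phi> (?y \<omega> k * v (\<sigma> k)))))"
    proof (rule avg_mono)
      fix \<sigma> assume \<sigma>: "\<sigma> \<in> perms n"
      have "avg (signs n) (\<lambda>\<delta>. \<bar>\<Sum>k=1..n. real_of_int (\<delta> k) * (v (\<sigma> k) * a k * rsum n x k \<omega>)\<bar>)
          \<le> sqrt (\<Sum>k=1..n. (v (\<sigma> k) * a k * rsum n x k \<omega>)\<^sup>2)"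
        using avg_abs_le_sqrt[OF finite_signs signs_ne]
        by (subst rademacher_moments(1)[symmetric]) auto
      also have "\<dots> = sqrt (r\<^sup>2 * (\<Sum>k=1..n. (?y \<omega> k * v (\<sigma> k))\<^sup>2))"
        using r unfolding sum_distrib_left
        by (intro arg_cong[where f = sqrt] sum.cong) (auto simp: power_mult_distrib power_divide)
      also have "\<dots> = r * sqrt (\<Sum>k=1..n. (?y \<omega> k * v (\<sigma> k))\<^sup>2)"
        using r by (simp add: real_sqrt_mult)
      also have "\<dots> \<le> r * (1/2 + (\<Sum>k=1..n. \<phi> (?y \<omega> k * v (\<sigma> k))))"
        using r y v_perm[OF \<sigma>] by (intro mult_left_mono sqrt_sum_le_phi mult_nonneg_nonneg) auto
      finally show "avg (signs n) (\<lambda>\<delta>. \<bar>\<Sum>k=1..n. real_of_int (\<delta> k) * (v (\<sigma> k) * a k * rsum n x k \<omega>)\<bar>)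
          \<le> r * (1/2 + (\<Sum>k=1..n. \<phi> (?y \<omega> k * v (\<sigma> k))))" .
    qed
    also have "\<dots> = r * (1/2 + (\<Sum>k=1..n. avg (perms n) (\<lambda>\<sigma>. \<phi> (?y \<omega> k * v (\<sigma> k)))))"
      by (simp only: avg_cmult avg_add avg_sum avg_const[OF finite_perms perms_ne])
    also have "\<dots> = r * (1/2 + (\<Sum>k=1..n. avg {1..n} (\<lambda>j. \<phi> (?y \<omega> k * v j))))"
      by (intro arg_cong[where f = "\<lambda>s. r * (1/2 + s)"] sum.cong refl
          avg_permutes_apply[where f = "\<lambda>j. \<phi> (?y \<omega> k * v j)" for k]) auto
    also have "\<dots> \<le> r * (1/2 + (\<Sum>k=1..n. M (?y \<omega> k) / (2 - p)))"
      using r by (intro mult_left_mono add_left_mono sum_mono v_upper y) auto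
    finally show "avg (perms n) (\<lambda>\<sigma>. avg (signs n) (\<lambda>\<delta>. \<bar>\<Sum>k=1..n. real_of_int (\<delta> k) * (v (\<sigma> k) * a k * rsum n x k \<omega>)\<bar>))
        \<le> r * (1/2 + (\<Sum>k=1..n. M (?y \<omega> k) / (2 - p)))" .
  qed
  also have "\<dots> = r * (1/2 + (\<Sum>k=1..n. avg \<Omega> (\<lambda>\<omega>. M (?y \<omega> k)) / (2 - p)))"
    by (simp only: avg_cmult avg_add avg_sum avg_divide avg_const[OF finite_\<Omega> \<Omega>_ne])
  finally show ?thesis by (simp add: sum_divide_distrib)
qed

text \<open>\<open>U\<close> and \<open>W\<close> are the head and tail averages of the
  rearrangement, in the form in which the two assumed norm inequalities contain them.\<close>

definition "U x k = (1 / real k * (\<Sum>i=1..k. \<bar>rearr n x i\<bar> powr p)) powr (1 / p)"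
definition "W x k = sqrt (1 / real k * (\<Sum>i=k+1..n. \<bar>rearr n x i\<bar>\<^sup>2))"

text \<open>Split \<open>x\<close> into its \<open>k\<close> largest coordinates \<open>y\<close>,
  estimated by the moment of order \<open>p\<close>, and the rest \<open>z\<close>, estimated by the
  second moment. The 2 in the denominator pays for the splitting.\<close>

lemma avg_M_rsum_le:
  assumes k: "k \<in> {1..n}" and \<rho>: "0 < \<rho>"
  shows "avg \<Omega> (\<lambda>\<omega>. M (a k * \<bar>rsum n x k \<omega>\<bar> / (2 * \<rho>)))
    \<le> 2 * M (a k * U x k / \<rho>) + 2 * M (a k * W x k / \<rho>)"
proof -
  obtain \<tau> where \<tau>: "bij_betw \<tau> {1..n} {1..n}" "\<forall>j\<in>{1..n}. rearr n x j = \<bar>x (\<tau> j)\<bar>"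
    using rearr_permutation[of n x] by (elim exE conjE) (rule that)
  define B where "B = \<tau> ` {1..k}"
  define y where "y i = (if i \<in> B then x i else 0)" for i
  define z where "z i = (if i \<in> B then 0 else x i)" for i
  have inj: "inj_on \<tau> {1..n}" using \<tau>(1) by (rule bij_betw_imp_inj_on)
  have reindex: "(\<Sum>i=1..n. g i) = (\<Sum>j=1..n. g (\<tau> j))" for g :: "nat \<Rightarrow> real"
    using sum.reindex_bij_betw[OF \<tau>(1), of g] by simp
  have B: "\<tau> j \<in> B \<longleftrightarrow> j \<le> k" if "j \<in> {1..n}" for j
  proof -
    have "{1..k} \<subseteq> {1..n}" using k by simp
    with inj that have "\<tau> j \<in> B \<longleftrightarrow> j \<in> {1..k}"
      unfolding B_def by (rule inj_on_image_mem_iff)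
    then show ?thesis using that by simp
  qed
  have ysum: "(\<Sum>i=1..n. \<bar>y i\<bar> powr p) = (\<Sum>i=1..k. \<bar>rearr n x i\<bar> powr p)"
  proof -
    have "(\<Sum>i=1..n. \<bar>y i\<bar> powr p) = (\<Sum>j=1..n. \<bar>y (\<tau> j)\<bar> powr p)"
      by (rule reindex)
    also have "\<dots> = (\<Sum>j=1..n. if j \<in> {1..k} then \<bar>rearr n x j\<bar> powr p else 0)"
    proof (rule sum.cong)
      fix j assume "j \<in> {1..n}"
      then show "\<bar>y (\<tau> j)\<bar> powr p = (if j \<in> {1..k} then \<bar>rearr n x j\<bar> powr p else 0)"
        using B[of j] bspec[OF \<tau>(2), of j] by (simp add: y_def)
    qed simp
    also have "\<dots> = (\<Sum>j\<in>{1..n} \<inter> {1..k}. \<bar>rearr n x j\<bar> powr p)"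
      by (simp only: sum.inter_restrict finite_atLeastAtMost)
    also have "{1..n} \<inter> {1..k} = {1..k}" using k by auto
    finally show ?thesis .
  qed
  have zsum: "(\<Sum>i=1..n. (z i)\<^sup>2) = (\<Sum>i=k+1..n. \<bar>rearr n x i\<bar>\<^sup>2)"
  proof -
    have "(\<Sum>i=1..n. (z i)\<^sup>2) = (\<Sum>j=1..n. (z (\<tau> j))\<^sup>2)"
      by (rule reindex)
    also have "\<dots> = (\<Sum>j=1..n. if j \<in> {k+1..n} then \<bar>rearr n x j\<bar>\<^sup>2 else 0)"
    proof (rule sum.cong)
      fix j assume "j \<in> {1..n}"
      then show "(z (\<tau> j))\<^sup>2 = (if j \<in> {k+1..n} then \<bar>rearr n x j\<bar>\<^sup>2 else 0)"
        using B[of j] bspec[OF \<tau>(2), of j] by (auto simp: z_def)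
    qed simp
    also have "\<dots> = (\<Sum>j\<in>{1..n} \<inter> {k+1..n}. \<bar>rearr n x j\<bar>\<^sup>2)"
      by (simp only: sum.inter_restrict finite_atLeastAtMost)
    also have "{1..n} \<inter> {k+1..n} = {k+1..n}" using k by auto
    finally show ?thesis .
  qed
  have x_eq: "x = (\<lambda>i. y i + z i)" by (auto simp: y_def z_def)
  define c where "c = a k / \<rho>"
  have c: "0 < c" using a[OF k] \<rho> by (simp add: c_def)
  have "avg \<Omega> (\<lambda>\<omega>. M (a k * \<bar>rsum n x k \<omega>\<bar> / (2 * \<rho>)))
      \<le> avg \<Omega> (\<lambda>\<omega>. M (c * \<bar>rsum n y k \<omega>\<bar>) + M (c * \<bar>rsum n z k \<omega>\<bar>))"
  proof (rule avg_mono)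
    fix \<omega>
    have "a k * \<bar>rsum n x k \<omega>\<bar> / (2 * \<rho>) = c * \<bar>rsum n x k \<omega>\<bar> / 2"
      by (simp add: c_def)
    also have "\<dots> \<le> (c * \<bar>rsum n y k \<omega>\<bar> + c * \<bar>rsum n z k \<omega>\<bar>) / 2"
      unfolding distrib_left[symmetric] using c
      by (intro divide_right_mono mult_left_mono) (subst x_eq, auto simp: rsum_add)
    finally have "M (a k * \<bar>rsum n x k \<omega>\<bar> / (2 * \<rho>)) \<le> M ((c * \<bar>rsum n y k \<omega>\<bar> + c * \<bar>rsum n z k \<omega>\<bar>) / 2)"
      using a[OF k] \<rho> by (intro M_mono) auto
    also have "\<dots> \<le> M (c * \<bar>rsum n y k \<omega>\<bar>) + M (c * \<bar>rsum n z k \<omega>\<bar>)"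
      using c by (intro M_half_add) auto
    finally show "M (a k * \<bar>rsum n x k \<omega>\<bar> / (2 * \<rho>)) \<le> M (c * \<bar>rsum n y k \<omega>\<bar>) + M (c * \<bar>rsum n z k \<omega>\<bar>)" .
  qed
  also have "\<dots> = avg \<Omega> (\<lambda>\<omega>. M (c * \<bar>rsum n y k \<omega>\<bar>)) + avg \<Omega> (\<lambda>\<omega>. M (c * \<bar>rsum n z k \<omega>\<bar>))"
    by (rule avg_add)
  also have "\<dots> \<le> 2 * M (c * U x k) + 2 * M (c * W x k)"
  proof (rule add_mono)
    have "U x k powr p = (1 / real k * (\<Sum>i=1..k. \<bar>rearr n x i\<bar> powr p)) powr 1"
      unfolding U_def powr_powr using p by simp
    also have "\<dots> = 1 / real k * (\<Sum>i=1..k. \<bar>rearr n x i\<bar> powr p)"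
      by (intro powr_one mult_nonneg_nonneg sum_nonneg) auto
    finally have "avg \<Omega> (\<lambda>\<omega>. \<bar>rsum n y k \<omega>\<bar> powr p) \<le> U x k powr p"
      using rsum_powr_moment[OF k p, of y] by (simp only: ysum)
    then show "avg \<Omega> (\<lambda>\<omega>. M (c * \<bar>rsum n y k \<omega>\<bar>)) \<le> 2 * M (c * U x k)"
      by (intro avg_M_le_powr finite_\<Omega> \<Omega>_ne c) (auto simp: U_def)
    have "(W x k)\<^sup>2 = 1 / real k * (\<Sum>i=k+1..n. \<bar>rearr n x i\<bar>\<^sup>2)"
      unfolding W_def by (intro real_sqrt_pow2 mult_nonneg_nonneg sum_nonneg) auto
    then have "avg \<Omega> (\<lambda>\<omega>. \<bar>rsum n z k \<omega>\<bar>\<^sup>2) \<le> (W x k)\<^sup>2"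
      using rsum_square_moment[OF k, of z] by (simp only: zsum power2_abs)
    then show "avg \<Omega> (\<lambda>\<omega>. M (c * \<bar>rsum n z k \<omega>\<bar>)) \<le> 2 * M (c * W x k)"
      by (intro avg_M_le_square finite_\<Omega> \<Omega>_ne c) (auto simp: W_def sum_nonneg)
  qed
  finally show ?thesis by (simp add: c_def)
qed

text \<open>Running averages of a non-increasing sequence: the next entry is at most every earlier
  one, hence at most their average.\<close>

lemma U_antimono:
  assumes "1 \<le> i" "i \<le> j" "j \<le> n"
  shows "U x j \<le> U x i"
proof -
  define h where "h k = 1 / real k * (\<Sum>i=1..k. \<bar>rearr n x i\<bar> powr p)" for k
  have "h j \<le> h i"
    using assms(2,3)
  proof (induction j rule: dec_induct)
    case (step k)
    let ?r = "\<bar>rearr n x (Suc k)\<bar> powr p" and ?S = "\<Sum>i=1..k. \<bar>rearr n x i\<bar> powr p"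
    have k: "0 < real k" using step assms(1) by auto
    have "(\<Sum>i=1..k. ?r) \<le> ?S"
    proof (rule sum_mono)
      fix l assume "l \<in> {1..k}"
      then show "?r \<le> \<bar>rearr n x l\<bar> powr p"
        using rearr_antimono[of l "Suc k" n x] rearr_nonneg[of "Suc k" n x] step p
        by (intro powr_mono2) auto
    qed
    then have "real k * ?r \<le> ?S" by simp
    then have "h (Suc k) \<le> h k"
      using k by (simp add: h_def field_simps)
    with step show ?case by simp
  qed simp
  then show ?thesis
    unfolding U_def h_def[symmetric] using p
    by (intro powr_mono2) (auto simp: h_def intro!: divide_nonneg_nonneg sum_nonneg)
qed

lemma W_antimono:
  assumes "1 \<le> i" "i \<le> j" "j \<le> n"
  shows "W x j \<le> W x i"
  unfolding W_def using assms
  by (intro real_sqrt_le_mono mult_mono sum_mono2 divide_left_mono sum_nonneg) auto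

text \<open>Both modulars at \<open>\<rho>\<close> are at most 1, so the averages of
  \<open>M\<close> sum to at most 4; take \<open>r = 2 * \<rho>\<close> in
  \<open>l1_norm_le_phi\<close>.\<close>

lemma l1_norm_upper:
  assumes "orlicz_lorentz_norm n M a (U x) < \<rho>" "orlicz_lorentz_norm n M a (W x) < \<rho>" "0 < \<rho>"
  shows "l1_norm n (T x) \<le> (1 + 8 / (2 - p)) * \<rho>"
proof -
  have rU: "rearr n (U x) k = U x k" if "k \<in> {1..n}" for k
    by (rule rearr_of_antimono[OF U_antimono _ that]) (simp_all add: U_def)
  have rW: "rearr n (W x) k = W x k" if "k \<in> {1..n}" for k
    by (rule rearr_of_antimono[OF W_antimono _ that]) (simp_all add: W_def sum_nonneg)
  have "(\<Sum>k=1..n. avg \<Omega> (\<lambda>\<omega>. M (a k * \<bar>rsum n x k \<omega>\<bar> / (2 * \<rho>))))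
      \<le> (\<Sum>k=1..n. 2 * M (a k * U x k / \<rho>) + 2 * M (a k * W x k / \<rho>))"
    using assms(3) by (intro sum_mono avg_M_rsum_le) auto
  also have "\<dots> = 2 * (\<Sum>k=1..n. M (a k * rearr n (U x) k / \<rho>))
      + 2 * (\<Sum>k=1..n. M (a k * rearr n (W x) k / \<rho>))"
    by (simp add: sum.distrib sum_distrib_left rU rW)
  also have "\<dots> \<le> 4"
    using modular_le_1[OF a assms(1)] modular_le_1[OF a assms(2)] by simp
  finally have "(2 * \<rho>) * (1/2 + (\<Sum>k=1..n. avg \<Omega> (\<lambda>\<omega>. M (a k * \<bar>rsum n x k \<omega>\<bar> / (2 * \<rho>)))) / (2 - p))
      \<le> (2 * \<rho>) * (1/2 + 4 / (2 - p))"
    using assms(3) p by (intro mult_left_mono add_left_mono divide_right_mono) auto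
  then show ?thesis
    using l1_norm_le_phi[of "2 * \<rho>" x] assms(3) by (simp add: algebra_simps)
qed

text \<open>\<open>v_lower\<close> does not cover values of \<open>M\<close> below
  \<open>1 / n\<close>, but these add up to at most 1. Doubling the arguments raises the modular
  above 2, so more than 1 remains. A single value of at least 1 suffices by itself.\<close>

lemma sum_phi_ge:
  assumes z: "\<And>k. k \<in> {1..n} \<Longrightarrow> 0 \<le> z k" and sum: "1 < (\<Sum>k=1..n. M (z k))"
  shows "1/3 \<le> (\<Sum>k=1..n. avg {1..n} (\<lambda>j. \<phi> (2 * z k * v j)))"
proof -
  let ?\<Phi> = "\<lambda>k. avg {1..n} (\<lambda>j. \<phi> (2 * z k * v j))"
  have \<Phi>: "0 \<le> ?\<Phi> k" if "k \<in> {1..n}" for k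
    using that z v by (intro avg_nonneg phi_nonneg) auto
  have z2: "0 \<le> 2 * z k" if "k \<in> {1..n}" for k using z[OF that] by simp
  show ?thesis
  proof (cases "\<exists>k\<in>{1..n}. 1 \<le> M (2 * z k)")
    case True
    then obtain k where k: "k \<in> {1..n}" "1 \<le> M (2 * z k)" by blast
    have "1 / real n \<le> 1" using n by simp
    then have "1 / real n \<le> M (2 * z k)" using k(2) by (rule order_trans)
    from v_lower[OF z2[OF k(1)] this] have "1/3 \<le> ?\<Phi> k"
      using k(2) by (simp add: min_absorb2)
    also have "\<dots> \<le> (\<Sum>k=1..n. ?\<Phi> k)"
      using k \<Phi> by (intro member_le_sum) auto
    finally show ?thesis .
  next
    case False
    have "2 * (\<Sum>k=1..n. M (z k)) \<le> (\<Sum>k=1..n. M (2 * z k))"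
      unfolding sum_distrib_left using z by (intro sum_mono M_double) auto
    also have "\<dots> \<le> (\<Sum>k=1..n. 3 * ?\<Phi> k + 1 / real n)"
    proof (rule sum_mono)
      fix k assume k: "k \<in> {1..n}"
      then have "M (2 * z k) < 1" using False by force
      then have "M (2 * z k) \<le> 3 * ?\<Phi> k" if "1 / real n \<le> M (2 * z k)"
        using v_lower[OF z2[OF k] that] by simp
      moreover have "0 \<le> 1 / real n" by simp
      ultimately show "M (2 * z k) \<le> 3 * ?\<Phi> k + 1 / real n"
        using \<Phi>[OF k] by linarith
    qed
    also have "\<dots> = 3 * (\<Sum>k=1..n. ?\<Phi> k) + 1"
      using n by (simp add: sum.distrib sum_distrib_left)
    finally show ?thesis using sum by simp
  qed
qed

text \<open>Khintchine's inequality handles \<open>\<delta>\<close>, the triangle inequality moves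
  the average over \<open>\<omega>\<close> inside the Euclidean norm, where
  \<open>rsum_abs_ge\<close> applies, and \<open>avg_permutes_sqrt_ge\<close> with
  \<open>q = 1/3\<close> handles \<open>\<sigma>\<close>.\<close>

lemma l1_norm_lower:
  assumes \<rho>: "0 < \<rho>" and mod: "1 < (\<Sum>k=1..n. M (a k * rearr n x k / \<rho>))"
  shows "\<rho> / 100 \<le> l1_norm n (T x)"
proof -
  define z where "z k = a k * rearr n x k / \<rho>" for k
  have z: "0 \<le> z k" if "k \<in> {1..n}" for k
    unfolding z_def using a[OF that] rearr_nonneg[OF that] \<rho> by simp
  \<comment> \<open>The factors come from Khintchine's inequality, from \<open>rsum_abs_ge\<close>,
    and from undoing the scaling in \<open>2 * z k\<close>.\<close>
  define C where "C = 1 / sqrt 3 * (1 / (2 * sqrt 6)) * (\<rho> / 2)"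
  have C: "0 < C" using \<rho> by (simp add: C_def)
  have "1/3 \<le> (\<Sum>k=1..n. avg {1..n} (\<lambda>j. \<phi> (2 * z k * v j)))"
    using z mod unfolding z_def[symmetric] by (rule sum_phi_ge)
  then have "(1/3) / sqrt (1 + 2 * (1/3))
      \<le> avg (perms n) (\<lambda>\<sigma>. sqrt (\<Sum>k\<in>{1..n}. (2 * z k * v (\<sigma> k))\<^sup>2))"
    using z v by (intro avg_permutes_sqrt_ge) auto
  then have "C * ((1/3) / sqrt (1 + 2 * (1/3)))
      \<le> C * avg (perms n) (\<lambda>\<sigma>. sqrt (\<Sum>k\<in>{1..n}. (2 * z k * v (\<sigma> k))\<^sup>2))"
    using C by (intro mult_left_mono) auto
  also have "\<dots> = avg (perms n) (\<lambda>\<sigma>. C * sqrt (\<Sum>k\<in>{1..n}. (2 * z k * v (\<sigma> k))\<^sup>2))"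
    by (simp only: avg_cmult)
  also have "\<dots> \<le> avg (perms n) (\<lambda>\<sigma>. avg \<Omega> (\<lambda>\<omega>. avg (signs n)
      (\<lambda>\<delta>. \<bar>\<Sum>k=1..n. real_of_int (\<delta> k) * (v (\<sigma> k) * a k * rsum n x k \<omega>)\<bar>)))"
  proof (rule avg_mono)
    fix \<sigma> assume \<sigma>: "\<sigma> \<in> perms n"
    let ?g = "\<lambda>k \<omega>. v (\<sigma> k) * a k * \<bar>rsum n x k \<omega>\<bar>"
    have "L2_set (\<lambda>k. (\<rho> / (4 * sqrt 6)) * (2 * z k * v (\<sigma> k))) {1..n}
        = \<rho> / (4 * sqrt 6) * L2_set (\<lambda>k. 2 * z k * v (\<sigma> k)) {1..n}"
      using \<rho> by (intro L2_set_right_distrib[symmetric]) auto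
    then have "C * sqrt (\<Sum>k\<in>{1..n}. (2 * z k * v (\<sigma> k))\<^sup>2)
        = 1 / sqrt 3 * L2_set (\<lambda>k. (\<rho> / (4 * sqrt 6)) * (2 * z k * v (\<sigma> k))) {1..n}"
      by (simp only:) (simp add: C_def L2_set_def)
    also have "\<dots> \<le> 1 / sqrt 3 * L2_set (\<lambda>k. avg \<Omega> (?g k)) {1..n}"
    proof (intro mult_left_mono L2_set_mono)
      fix k assume k: "k \<in> {1..n}"
      have "(\<rho> / (4 * sqrt 6)) * (2 * z k * v (\<sigma> k)) = (v (\<sigma> k) * a k) * (rearr n x k / (2 * sqrt 6))"
        using \<rho> by (simp add: z_def)
      also have "\<dots> \<le> (v (\<sigma> k) * a k) * avg \<Omega> (\<lambda>\<omega>. \<bar>rsum n x k \<omega>\<bar>)"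
        using v_perm[OF \<sigma> k] a[OF k] by (intro mult_left_mono rsum_abs_ge k) auto
      finally show "(\<rho> / (4 * sqrt 6)) * (2 * z k * v (\<sigma> k)) \<le> avg \<Omega> (?g k)"
        by (simp only: avg_cmult)
      show "0 \<le> (\<rho> / (4 * sqrt 6)) * (2 * z k * v (\<sigma> k))"
        using \<rho> z[OF k] v_perm[OF \<sigma> k] by simp
    qed auto
    also have "\<dots> \<le> 1 / sqrt 3 * avg \<Omega> (\<lambda>\<omega>. L2_set (\<lambda>k. ?g k \<omega>) {1..n})"
      by (intro mult_left_mono L2_set_avg_le) auto
    also have "\<dots> = avg \<Omega> (\<lambda>\<omega>. 1 / sqrt 3 * L2_set (\<lambda>k. ?g k \<omega>) {1..n})"
      by (simp only: avg_cmult)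
    also have "\<dots> \<le> avg \<Omega> (\<lambda>\<omega>. avg (signs n)
      (\<lambda>\<delta>. \<bar>\<Sum>k=1..n. real_of_int (\<delta> k) * (v (\<sigma> k) * a k * rsum n x k \<omega>)\<bar>))"
    proof (rule avg_mono)
      fix \<omega>
      have "1 / sqrt 3 * L2_set (\<lambda>k. ?g k \<omega>) {1..n}
          = sqrt (\<Sum>k\<in>{1..n}. (v (\<sigma> k) * a k * rsum n x k \<omega>)\<^sup>2) / sqrt 3"
        by (simp add: L2_set_def power_mult_distrib)
      also have "\<dots> \<le> avg (signs n)
          (\<lambda>\<delta>. \<bar>\<Sum>k=1..n. real_of_int (\<delta> k) * (v (\<sigma> k) * a k * rsum n x k \<omega>)\<bar>)"
        by (rule khintchine_lower) simp
      finally show "1 / sqrt 3 * L2_set (\<lambda>k. ?g k \<omega>) {1..n} \<le> avg (signs n)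
          (\<lambda>\<delta>. \<bar>\<Sum>k=1..n. real_of_int (\<delta> k) * (v (\<sigma> k) * a k * rsum n x k \<omega>)\<bar>)" .
    qed
    finally show "C * sqrt (\<Sum>k\<in>{1..n}. (2 * z k * v (\<sigma> k))\<^sup>2)
      \<le> avg \<Omega> (\<lambda>\<omega>. avg (signs n)
        (\<lambda>\<delta>. \<bar>\<Sum>k=1..n. real_of_int (\<delta> k) * (v (\<sigma> k) * a k * rsum n x k \<omega>)\<bar>))" .
  qed
  also have "\<dots> = l1_norm n (T x)"
    unfolding l1_norm_embedding by (rule avg_swap)
  finally have 1: "C * ((1/3) / sqrt (1 + 2 * (1/3))) \<le> l1_norm n (T x)" .
  \<comment> \<open>The accumulated constant is \<open>\<rho> / (12 * sqrt 30)\<close>, and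
    \<open>12 * 25/3 = 100\<close>.\<close>
  have "sqrt 3 * sqrt 6 * sqrt (5/3) = sqrt 30"
    by (simp add: real_sqrt_mult[symmetric])
  moreover have "sqrt 30 \<le> 25/3"
    by (intro real_le_lsqrt) (auto simp: power2_eq_square)
  ultimately have "\<rho> / 100 \<le> \<rho> / (12 * (sqrt 3 * sqrt 6 * sqrt (5/3)))"
    using \<rho> by (intro divide_left_mono mult_pos_pos) auto
  also have "\<dots> = C * ((1/3) / sqrt (1 + 2 * (1/3)))"
    by (simp add: C_def)
  finally show ?thesis using 1 by simp
qed

end

section \<open>Banach--Mazur distance and dimension\<close>

lemma op_norm_le:
  assumes "0 \<in> X" "NX 0 \<le> 1" "\<And>x. x \<in> X \<Longrightarrow> NX x \<le> 1 \<Longrightarrow> NY (F x) \<le> K"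
  shows "op_norm X NX NY F \<le> K"
  unfolding op_norm_def using assms by (intro cSup_least) auto

text \<open>The bound \<open>K\<close> makes the supremum an upper bound of its set, which contains
  the value at 0.\<close>

lemma op_norm_nonneg:
  assumes "0 \<in> X" "NX 0 \<le> 1" "\<And>x. x \<in> X \<Longrightarrow> NX x \<le> 1 \<Longrightarrow> NY (F x) \<le> K" "0 \<le> NY (F 0)"
  shows "0 \<le> op_norm X NX NY F"
proof -
  have "NY (F 0) \<le> op_norm X NX NY F"
    unfolding op_norm_def using assms(1-3) by (intro cSup_upper bdd_aboveI[of _ K]) auto
  with assms(4) show ?thesis by simp
qed

text \<open>\<open>F\<close> itself competes in the infimum. The infimum is at most its value
  because all competitors are nonnegative, which rests on the boundedness in both directions that
  \<open>linear_isomorphism\<close> demands.\<close>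

lemma banach_mazur_le:
  fixes F :: "'a::real_vector \<Rightarrow> 'b::real_vector"
  assumes F: "linear F" and X: "subspace X"
    and NX: "\<And>x. x \<in> X \<Longrightarrow> 0 \<le> NX x" "NX 0 = 0" and NY: "\<And>y. 0 \<le> NY y" "NY 0 = 0"
    and c: "0 < c" and lower: "\<And>x. x \<in> X \<Longrightarrow> c * NX x \<le> NY (F x)"
    and upper: "\<And>x. x \<in> X \<Longrightarrow> NY (F x) \<le> C * NX x" and C: "0 \<le> C" and inj: "inj_on F X"
  shows "banach_mazur X NX (F ` X) NY \<le> C / c"
proof -
  let ?Y = "F ` X"
  have X0: "0 \<in> X" using X by (rule subspace_0)
  have F0: "F 0 = 0" using F by (rule linear_0)
  have Y0: "0 \<in> ?Y" using X0 F0 by (metis image_eqI)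
  have inv: "NX (inv_into X F y) \<le> (1 / c) * NY y" if "y \<in> ?Y" for y
    using lower[of "inv_into X F y"] that c by (auto simp: f_inv_into_f inv_into_into field_simps)
  have "linear_isomorphism X NX ?Y NY F"
    unfolding linear_isomorphism_def bij_betw_def
  proof (intro conjI ballI allI)
    show "\<exists>K. \<forall>x\<in>X. NY (F x) \<le> K * NX x"
      using upper by (intro exI[of _ C]) auto
    show "\<exists>K. \<forall>y\<in>?Y. NX (inv_into X F y) \<le> K * NY y"
      using inv by (intro exI[of _ "1 / c"] ballI)
  qed (simp_all add: inj linear_add[OF F] linear_scale[OF F])
  moreover have "bdd_below {op_norm X NX NY T * op_norm ?Y NY NX (inv_into X T) | T.
      linear_isomorphism X NX ?Y NY T}"
  proof (rule bdd_belowI[of _ 0])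
    fix r assume "r \<in> {op_norm X NX NY T * op_norm ?Y NY NX (inv_into X T) | T.
      linear_isomorphism X NX ?Y NY T}"
    then obtain T where r: "r = op_norm X NX NY T * op_norm ?Y NY NX (inv_into X T)"
      and iso: "linear_isomorphism X NX ?Y NY T"
      by (elim CollectE exE conjE) (rule that)
    from iso obtain K L where T: "bij_betw T X ?Y" "\<forall>x\<in>X. NY (T x) \<le> K * NX x"
      "\<forall>y\<in>?Y. NX (inv_into X T y) \<le> L * NY y"
      unfolding linear_isomorphism_def by (elim exE conjE) (rule that)
    \<comment> \<open>The constants witnessing boundedness may be negative, hence the absolute
      value.\<close>
    have bd: "B * s \<le> \<bar>B\<bar>" if "0 \<le> s" "s \<le> 1" for B s :: real
      using that by (metis abs_ge_self abs_mult abs_of_nonneg mult_left_le abs_ge_zero order_trans)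
    have "0 \<le> op_norm X NX NY T"
    proof (rule op_norm_nonneg[where K = "\<bar>K\<bar>"])
      fix x assume x: "x \<in> X" "NX x \<le> 1"
      then show "NY (T x) \<le> \<bar>K\<bar>" using T(2) bd[OF NX(1)[OF x(1)] x(2), of K] by force
    qed (use X0 NX NY in auto)
    moreover have "0 \<le> op_norm ?Y NY NX (inv_into X T)"
    proof (rule op_norm_nonneg[where K = "\<bar>L\<bar>"])
      fix y assume y: "y \<in> ?Y" "NY y \<le> 1"
      then show "NX (inv_into X T y) \<le> \<bar>L\<bar>" using T(3) bd[OF NY(1) y(2), of L] by force
    next
      have "inv_into X T 0 \<in> X"
        using Y0 T(1) by (intro inv_into_into) (simp add: bij_betw_def)
      then show "0 \<le> NX (inv_into X T 0)" by (rule NX)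
    qed (use Y0 NY in auto)
    ultimately show "0 \<le> r" unfolding r by simp
  qed
  ultimately have "banach_mazur X NX ?Y NY \<le> op_norm X NX NY F * op_norm ?Y NY NX (inv_into X F)"
    unfolding banach_mazur_def by (intro cInf_lower) auto
  also have "\<dots> \<le> C * (1 / c)"
  proof (rule mult_mono)
    show "op_norm X NX NY F \<le> C"
    proof (rule op_norm_le)
      fix x assume "x \<in> X" "NX x \<le> 1"
      then show "NY (F x) \<le> C" using upper[of x] mult_left_le[of "NX x" C] C by simp
    qed (use X0 NX in auto)
    have bound: "NX (inv_into X F y) \<le> 1 / c" if "y \<in> ?Y" "NY y \<le> 1" for y
    proof -
      have "(1 / c) * NY y \<le> (1 / c) * 1" using that c by (intro mult_left_mono) auto
      then show ?thesis using inv[OF that(1)] by simp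
    qed
    show "op_norm ?Y NY NX (inv_into X F) \<le> 1 / c"
      by (rule op_norm_le) (use Y0 NY bound in auto)
    show "0 \<le> op_norm ?Y NY NX (inv_into X F)"
    proof (rule op_norm_nonneg[where K = "1 / c"])
      show "0 \<le> NX (inv_into X F 0)" using Y0 by (intro NX inv_into_into)
    qed (use Y0 NY bound in auto)
  qed (use C in auto)
  finally show ?thesis by simp
qed

section \<open>Coordinate spaces and dimension\<close>

lemma subspace_coord_space: "subspace (coord_space I)"
  by (rule subspaceI) (auto simp: coord_space_def scaleR_fun_def)

lemma coord_space_basis:
  fixes I :: "'i set"
  assumes I: "finite I"
  defines "e \<equiv> \<lambda>i. (\<lambda>j. of_bool (i = j)) :: 'i \<Rightarrow> real"
  shows "independent (e ` I)" "span (e ` I) = coord_space I" "inj_on e I"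
proof -
  have e: "e i j = of_bool (i = j)" for i j by (simp add: e_def)
  show inj: "inj_on e I"
  proof (rule inj_onI)
    fix i j assume "e i = e j"
    then have "e i i = e j i" by simp
    then show "i = j" by (simp add: e)
  qed
  have comb: "(\<Sum>i\<in>I. u i *\<^sub>R e i) j = (if j \<in> I then u j else 0)" for u j
  proof -
    have "(\<Sum>i\<in>A. u i *\<^sub>R e i) j = (\<Sum>i\<in>A. u i * e i j)" for A
      by (induction A rule: infinite_finite_induct) (auto simp: scaleR_fun_def)
    then show ?thesis using I by (simp add: e of_bool_def if_distrib cong: if_cong)
  qed
  show "independent (e ` I)"
    unfolding independent_explicit_module
  proof (intro allI impI ballI)
    fix t u w assume t: "finite t" "t \<subseteq> e ` I" "(\<Sum>w\<in>t. u w *\<^sub>R w) = 0" "w \<in> t"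
    then obtain j where j: "j \<in> I" "w = e j" by blast
    \<comment> \<open>The coefficients are extended by 0 from \<open>t\<close> to all unit vectors;
      evaluation at \<open>j\<close> then isolates the one of \<open>e j\<close>.\<close>
    have "(\<Sum>i\<in>I. (if e i \<in> t then u (e i) else 0) *\<^sub>R e i)
        = (\<Sum>w\<in>e ` I. (if w \<in> t then u w else 0) *\<^sub>R w)"
      by (simp add: sum.reindex[OF inj])
    also have "\<dots> = (\<Sum>w\<in>t. u w *\<^sub>R w)"
      using I t(2) by (intro sum.mono_neutral_cong_right) auto
    finally have "(\<Sum>i\<in>I. (if e i \<in> t then u (e i) else 0) *\<^sub>R e i) j = 0"
      using t(3) by simp
    then show "u w = 0" unfolding comb using j t(4) by simp
  qed
  show "span (e ` I) = coord_space I"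
  proof
    show "span (e ` I) \<subseteq> coord_space I"
      by (intro span_minimal subspace_coord_space) (auto simp: coord_space_def e_def)
    show "coord_space I \<subseteq> span (e ` I)"
    proof
      fix x :: "'i \<Rightarrow> real" assume "x \<in> coord_space I"
      then have "x = (\<Sum>i\<in>I. x i *\<^sub>R e i)"
        by (auto simp: fun_eq_iff comb coord_space_def)
      also have "\<dots> \<in> span (e ` I)"
        by (intro span_sum span_scale span_base) auto
      finally show "x \<in> span (e ` I)" .
    qed
  qed
qed

lemma dim_linear_image_coord_space:
  fixes F :: "('i \<Rightarrow> real) \<Rightarrow> 'b::real_vector"
  assumes "finite I" "linear F" "inj_on F (coord_space I)"
  shows "dim (F ` coord_space I) = card I"
proof -
  let ?e = "\<lambda>i. (\<lambda>j. of_bool (i = j)) :: 'i \<Rightarrow> real"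
  note b = coord_space_basis[OF assms(1)]
  show ?thesis
  proof (rule dim_unique)
    show "F ` ?e ` I \<subseteq> F ` coord_space I"
      using span_superset[of "?e ` I"] b(2) by blast
    show "F ` coord_space I \<subseteq> span (F ` ?e ` I)"
      using linear_span_image[OF assms(2), of "?e ` I"] b(2) by simp
    show "independent (F ` ?e ` I)"
      using assms(2,3) b by (intro linear_independent_injective_image) auto
    have "inj_on F (?e ` I)"
      using assms(3) span_superset[of "?e ` I"] b(2) by (metis inj_on_subset)
    then show "card (F ` ?e ` I) = card I"
      using b(3) by (simp add: card_image)
  qed
qed

theorem theorem1p1:
  fixes C1 C2 p :: real
  assumes "0 < C1" and "0 < C2" and "1 < p" and "p < 2"
  shows "\<exists>D>0. \<forall>(n::nat) (a :: nat \<Rightarrow> real) (M :: real \<Rightarrow> real).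
    n \<ge> 1 \<longrightarrow>
    antimono_on {1..n} a \<longrightarrow>
    (\<forall>i\<in>{1..n}. a i > 0) \<longrightarrow>
    orlicz_function M \<longrightarrow>
    (\<exists>\<epsilon>. 0 < \<epsilon> \<and> \<epsilon> < p - 1 \<and> antimono_on {0<..} (\<lambda>t. M t / t powr (p - \<epsilon>))) \<longrightarrow>
    (\<forall>x \<in> coord_space {1..n}.
      orlicz_lorentz_norm n M a
        (\<lambda>k. (1 / real k * (\<Sum>i=1..k. \<bar>rearr n x i\<bar> powr p)) powr (1 / p))
      \<le> C1 * orlicz_lorentz_norm n M a x) \<longrightarrow>
    (\<forall>x \<in> coord_space {1..n}.
      orlicz_lorentz_norm n M a
        (\<lambda>k. sqrt (1 / real k * (\<Sum>i=k+1..n. \<bar>rearr n x i\<bar>\<^sup>2)))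
      \<le> C2 * orlicz_lorentz_norm n M a x) \<longrightarrow>
    (\<exists>Y. subspace Y \<and> Y \<subseteq> coord_space (l1_indices n) \<and> dim Y = n \<and>
      banach_mazur (coord_space {1..n}) (orlicz_lorentz_norm n M a) Y (l1_norm n) \<le> D)"
proof -
  \<comment> \<open>The constant of \<open>l1_norm_upper\<close> at \<open>\<rho>\<close> equal to
    \<open>C1 + C2\<close> times the norm; it depends on \<open>p\<close>, \<open>C1\<close>,
    \<open>C2\<close> only.\<close>
  define C where "C = (1 + 8 / (2 - p)) * (C1 + C2)"
  have C: "0 < C" using assms by (simp add: C_def add_pos_pos)
  have main: "\<exists>Y. subspace Y \<and> Y \<subseteq> coord_space (l1_indices n) \<and> dim Y = n \<and>
      banach_mazur (coord_space {1..n}) (orlicz_lorentz_norm n M a) Y (l1_norm n) \<le> C / (1/200)"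
    if n: "1 \<le> n" and a: "\<forall>i\<in>{1..n}. a i > 0" and M: "orlicz_function M"
      and eps: "\<exists>\<epsilon>. 0 < \<epsilon> \<and> \<epsilon> < p - 1 \<and> antimono_on {0<..} (\<lambda>t. M t / t powr (p - \<epsilon>))"
      and H1: "\<forall>x \<in> coord_space {1..n}. orlicz_lorentz_norm n M a
        (\<lambda>k. (1 / real k * (\<Sum>i=1..k. \<bar>rearr n x i\<bar> powr p)) powr (1 / p))
        \<le> C1 * orlicz_lorentz_norm n M a x"
      and H2: "\<forall>x \<in> coord_space {1..n}. orlicz_lorentz_norm n M a
        (\<lambda>k. sqrt (1 / real k * (\<Sum>i=k+1..n. \<bar>rearr n x i\<bar>\<^sup>2)))
        \<le> C2 * orlicz_lorentz_norm n M a x"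
    for n :: nat and a M :: "_ \<Rightarrow> real"
  proof -
    obtain \<epsilon> where \<epsilon>: "0 < \<epsilon>" "antimono_on {0<..} (\<lambda>t. M t / t powr (p - \<epsilon>))"
      using eps by blast
    interpret p_orlicz M p
    proof
      \<comment> \<open>The quotient with exponent \<open>p\<close> is the assumed one times the
        decreasing factor \<open>t powr (- \<epsilon>)\<close>.\<close>
      show "antimono_on {0<..} (\<lambda>t. M t / t powr p)"
      proof (rule monotone_onI)
        fix s t :: real assume st: "s \<in> {0<..}" "t \<in> {0<..}" "s \<le> t"
        have M0: "0 \<le> M s" using M st by (auto simp: orlicz_function_def less_imp_le)
        have eq: "M r / r powr p = M r / r powr (p - \<epsilon>) * r powr (- \<epsilon>)" if "0 < r" for r
          using that by (simp add: powr_diff powr_minus field_simps)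
        have "M t / t powr (p - \<epsilon>) * t powr (- \<epsilon>) \<le> M s / s powr (p - \<epsilon>) * s powr (- \<epsilon>)"
          using st monotone_onD[OF \<epsilon>(2) st] M0 \<epsilon>(1)
          by (intro mult_mono powr_mono2') auto
        then show "M s / s powr p \<ge> M t / t powr p"
          using eq st by simp
      qed
    qed (use assms M in auto)
    obtain v where v: "\<And>j. j \<in> {1..n} \<Longrightarrow> 0 \<le> v j"
      "\<And>t. 0 \<le> t \<Longrightarrow> avg {1..n} (\<lambda>j. \<phi> (t * v j)) \<le> M t / (2 - p)"
      "\<And>t. 0 \<le> t \<Longrightarrow> 1 / real n \<le> M t \<Longrightarrow> min (M t) 1 \<le> 3 * avg {1..n} (\<lambda>j. \<phi> (t * v j))"
      using exists_weights[OF n] by blast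
    interpret orlicz_embedding M p n v a
      using n a v by unfold_locales auto
    let ?X = "coord_space {1..n} :: (nat \<Rightarrow> real) set" and ?N = "orlicz_lorentz_norm n M a"
    have l1: "0 \<le> l1_norm n y" for y
      unfolding l1_norm_eq_avg by (intro avg_nonneg) auto
    have N0: "0 \<le> ?N x" for x
      by (intro orlicz_lorentz_norm_nonneg a[rule_format])
    have zero: "(\<lambda>_. 0) = (0 :: 'z \<Rightarrow> real)" by (simp add: zero_fun_def)
    have l10: "l1_norm n 0 = 0" by (simp add: l1_norm_def)
    have N_eq_0: "x = 0" if "x \<in> ?X" "?N x = 0" for x
      using that orlicz_lorentz_norm_eq_0[OF a[rule_format] that(2)]
      by (auto simp: coord_space_def fun_eq_iff)
    have lower: "1/200 * ?N x \<le> l1_norm n (T x)" for x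
    proof (cases "?N x = 0")
      case False
      \<comment> \<open>Half the norm is a positive scale strictly below the infimum, so the modular
        exceeds 1 there; this costs the factor from 1/100 to 1/200.\<close>
      then have "0 < ?N x / 2" "?N x / 2 < ?N x" using N0[of x] by auto
      then show ?thesis using l1_norm_lower[OF _ modular_gt_1, of "?N x / 2" x] by simp
    qed (use l1 in simp)
    have upper: "l1_norm n (T x) \<le> C * ?N x" if x: "x \<in> ?X" for x
    proof (cases "?N x = 0")
      case True
      then have "x = 0" using x by (intro N_eq_0)
      then show ?thesis using True linear_0[OF linear_embedding] l10 by simp
    next
      case False
      then have pos: "0 < ?N x" using N0[of x] by simp
      have "?N (U x) \<le> C1 * ?N x" "?N (W x) \<le> C2 * ?N x"
        using H1 H2 x by (simp_all add: U_def[abs_def] W_def[abs_def])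
      \<comment> \<open>As \<open>C1\<close> and \<open>C2\<close> are positive, their sum gives the
        strict inequalities that \<open>l1_norm_upper\<close> requires.\<close>
      then have "?N (U x) < (C1 + C2) * ?N x" "?N (W x) < (C1 + C2) * ?N x" "0 < (C1 + C2) * ?N x"
        using pos assms by (auto simp: distrib_right intro: le_less_trans add_pos_pos)
      then show ?thesis using l1_norm_upper[of x "(C1 + C2) * ?N x"] by (simp add: C_def mult.assoc)
    qed
    have inj: "inj_on T ?X"
    proof (rule linear_inj_on_iff_eq_0[OF linear_embedding subspace_coord_space, THEN iffD2], intro ballI impI)
      fix x assume x: "x \<in> ?X" "T x = 0"
      then have "?N x \<le> 0" using lower[of x] l10 by simp
      then show "x = 0" using N0[of x] x by (intro N_eq_0) auto
    qed
    have "banach_mazur ?X ?N (T ` ?X) (l1_norm n) \<le> C / (1/200)"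
      using orlicz_lorentz_norm_0[of n a] lower upper inj C N0 l1 l10
      by (intro banach_mazur_le linear_embedding subspace_coord_space) (auto simp: zero)
    moreover have "subspace (T ` ?X)"
      by (intro linear_subspace_image linear_embedding subspace_coord_space)
    moreover have "T ` ?X \<subseteq> coord_space (l1_indices n)"
      using embedding_in_coord_space by blast
    moreover have "dim (T ` ?X) = n"
      using dim_linear_image_coord_space[OF _ linear_embedding inj] by simp
    ultimately show ?thesis by blast
  qed
  show ?thesis
  proof (rule exI, rule conjI)
    show "0 < C / (1/200)" using C by simp
  qed (intro allI impI, rule main)
qed

end
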